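(* Let $W$ be a tournamenton, let $T_n\sim T(n,W)$ with adjacency matrix $(a_{st})$, and let $$\hat t_{\mathrm{Tr}_4}(T_n)=\frac1{n(n-1)(n-2)(n-3)}\sum_{\substack{(s_1,s_2,s_3,s_4)\in[n]^4\\ \text{distinct}}}a_{s_1s_2}a_{s_1s_3}a_{s_1s_4}a_{s_2s_3}a_{s_2s_4}a_{s_3s_4}.$$ Then the following hold as $n\to\infty$: (1) If $W(x,y)=\frac12$ for almost every $(x,y)\in[0,1]^2$, then $n\big(\hat t_{\mathrm{Tr}_4}(T_n)-\frac1{64}\big)=O_P(1)$. (2) If $W(x,y)\ne\frac12$ on a set of positive measure, then $\hat t_{\mathrm{Tr}_4}(T_n)\xrightarrow{P}t(\mathrm{Tr}_4,W)\neq\frac1{64}$, where $$t(\mathrm{Tr}_4,W)=\int_{[0,1]^4}\prod_{1\le a<b\le4}W(x_a,x_b)\prod_{a=1}^4\mathrm dx_a .$$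
   Context: A tournamenton is a measurable function $W:[0,1]^2\to[0,1]$ with $W(x,y)+W(y,x)=1$ for all $x,y$. The $W$-random tournament $T_n\sim T(n,W)$ on $[n]$ has adjacency matrix $(a_{uv})$: $\eta_1,\dots,\eta_n$ are i.i.d. $\mathrm{Unif}([0,1])$ and, conditionally, $a_{uv}\sim\mathrm{Ber}(W(\eta_u,\eta_v))$ independently for $u<v$, with $a_{vu}=1-a_{uv}$. $\mathrm{Tr}_4$ denotes the transitive tournament on 4 vertices (edges $a\to b$ for $1\le a<b\le4$). *)

theory Defs
  imports "HOL-Probability.Probability"
begin

text \<open>Measurability is Lebesgue measurability on the unit square.\<close>

definition tournamenton :: "(real \<Rightarrow> real \<Rightarrow> real) \<Rightarrow> bool" where
  "tournamenton W \<longleftrightarrow>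
     (\<lambda>(x, y). W x y) \<in> borel_measurable (lebesgue_on ({0..1} \<times> {0..1})) \<and>
     (\<forall>x\<in>{0..1}. \<forall>y\<in>{0..1}. 0 \<le> W x y \<and> W x y \<le> 1 \<and> W x y + W y x = 1)"

text \<open>The joint law of \<open>\<eta>\<^sub>1, \<dots>, \<eta>\<^sub>n\<close>. It is completed because \<open>W\<close> is only assumed
  Lebesgue measurable, so that \<open>\<eta> \<mapsto> W (\<eta> u) (\<eta> v)\<close> need not be measurable
  for the product sigma-algebra itself; the completion also makes the values of \<open>W\<close> outside
  the unit square irrelevant.\<close>

definition latent_measure :: "nat \<Rightarrow> (nat \<Rightarrow> real) measure" where
  "latent_measure n = completion (\<Pi>\<^sub>M i\<in>{1..n}. uniform_measure lborel {0..1})"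

text \<open>Only the values \<open>b (u, v)\<close> with \<open>u < v\<close> are used. Adjacency is set to
  \<open>False\<close> on the diagonal and off \<open>[n]\<close>, so a tournament on \<open>[n]\<close>
  has exactly one representation, and there are finitely many of them.\<close>

definition orient :: "nat \<Rightarrow> (nat \<times> nat \<Rightarrow> bool) \<Rightarrow> nat \<Rightarrow> nat \<Rightarrow> bool" where
  "orient n b u v \<longleftrightarrow> u \<in> {1..n} \<and> v \<in> {1..n} \<and>
     (u < v \<and> b (u, v) \<or> v < u \<and> \<not> b (v, u))"

text \<open>The conditional law of the tournament given \<open>\<eta>\<close>.\<close>

definition conditional_tournament ::
    "nat \<Rightarrow> (real \<Rightarrow> real \<Rightarrow> real) \<Rightarrow> (nat \<Rightarrow> real) \<Rightarrow> (nat \<Rightarrow> nat \<Rightarrow> bool) pmf" where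
  "conditional_tournament n W \<eta> =
     map_pmf (orient n)
       (Pi_pmf {(u, v). 1 \<le> u \<and> u < v \<and> v \<le> n} False
          (\<lambda>(u, v). bernoulli_pmf (W (\<eta> u) (\<eta> v))))"

text \<open>The law \<open>T(n,W)\<close>, a measure on the discrete space of all relations on \<open>nat\<close>.\<close>

definition tournament_law ::
    "nat \<Rightarrow> (real \<Rightarrow> real \<Rightarrow> real) \<Rightarrow> (nat \<Rightarrow> nat \<Rightarrow> bool) measure" where
  "tournament_law n W =
     latent_measure n \<bind> (\<lambda>\<eta>. measure_pmf (conditional_tournament n W \<eta>))"

definition W_random_tournament ::
    "'a measure \<Rightarrow> nat \<Rightarrow> (real \<Rightarrow> real \<Rightarrow> real) \<Rightarrow> ('a \<Rightarrow> nat \<Rightarrow> nat \<Rightarrow> bool) \<Rightarrow> bool" where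
  "W_random_tournament M n W T \<longleftrightarrow>
     prob_space M \<and> T \<in> M \<rightarrow>\<^sub>M count_space UNIV \<and>
     distr M (count_space UNIV) T = tournament_law n W"

definition t_hat_Tr4 :: "nat \<Rightarrow> (nat \<Rightarrow> nat \<Rightarrow> bool) \<Rightarrow> real" where
  "t_hat_Tr4 n a =
     1 / (real n * (real n - 1) * (real n - 2) * (real n - 3)) *
     (\<Sum>(s1, s2, s3, s4) \<in> {(s1, s2, s3, s4).
          {s1, s2, s3, s4} \<subseteq> {1..n} \<and> distinct [s1, s2, s3, s4]}.
        of_bool (a s1 s2) * of_bool (a s1 s3) * of_bool (a s1 s4) *
        of_bool (a s2 s3) * of_bool (a s2 s4) * of_bool (a s3 s4))"

definition t_Tr4 :: "(real \<Rightarrow> real \<Rightarrow> real) \<Rightarrow> real" where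
  "t_Tr4 W =
     (LINT x : (\<Pi>\<^sub>E i\<in>{1..4::nat}. {0..1}) | completion (\<Pi>\<^sub>M i\<in>{1..4}. lborel).
        (\<Prod>(a, b) \<in> {(a, b). 1 \<le> a \<and> a < b \<and> b \<le> 4}. W (x a) (x b)))"

text \<open>Both notions allow the underlying probability space to vary with \<open>n\<close>.\<close>

definition bounded_in_prob :: "(nat \<Rightarrow> 'a measure) \<Rightarrow> (nat \<Rightarrow> 'a \<Rightarrow> real) \<Rightarrow> bool" where
  "bounded_in_prob M X \<longleftrightarrow>
     (\<forall>\<epsilon>>0. \<exists>K>0. \<forall>\<^sub>F n in sequentially.
        measure (M n) {\<omega> \<in> space (M n). \<bar>X n \<omega>\<bar> > K} \<le> \<epsilon>)"

definition tendsto_in_prob :: "(nat \<Rightarrow> 'a measure) \<Rightarrow> (nat \<Rightarrow> 'a \<Rightarrow> real) \<Rightarrow> real \<Rightarrow> bool" where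
  "tendsto_in_prob M X c \<longleftrightarrow>
     (\<forall>\<epsilon>>0. (\<lambda>n. measure (M n) {\<omega> \<in> space (M n). \<bar>X n \<omega> - c\<bar> > \<epsilon>}) \<longlonglongrightarrow> 0)"

end

theory Submission
  imports Defs
begin

text \<open>Write \<open>f = W - 1/2\<close>, an antisymmetric kernel. Averaging the six-fold product over the
  \<open>24\<close> orderings of four vertices and expanding in \<open>f\<close>, every term of odd degree
  cancels against the reversed ordering, and so do the pairs of disjoint edges, the triangles with a
  pendant edge and the full \<open>K\<^sub>4\<close>, each of which has a symmetry that changes its
  sign. Only the paths with two edges and the cycles with four edges survive (\<open>tr4_symmetrisation\<close>), and integration gives

    \<open>t(Tr\<^sub>4, W) = 1/64 + 1/4 \<integral> d\<^sup>2 + 1/4 \<integral>\<integral> g\<^sup>2\<close>,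
    where \<open>d(x) = \<integral> f(x,y) dy\<close> and \<open>g(x,z) = \<integral> f(x,y) f(y,z) dy\<close>

  (\<open>density_tr4_expansion\<close>). Hence the value \<open>1/64\<close> forces \<open>g = 0\<close> almost
  everywhere. Then the operator with kernel \<open>f\<close> kills every indicator function, \<open>f\<close>
  integrates to zero over every rectangle, and \<open>f = 0\<close> almost everywhere
  (\<open>density_tr4_eq_iff\<close>).

  Both probabilistic claims are Chebyshev bounds for the average of the indicators that an ordered
  quadruple is transitive in its given order. Each indicator has mean \<open>t(Tr\<^sub>4, W)\<close>, so
  the variance is at most the proportion of correlated pairs of quadruples. For general \<open>W\<close>,
  disjoint quadruples are independent, so at most \<open>16 n\<^sup>7\<close> of about \<open>n\<^sup>8\<close>
  pairs matter and the variance is \<open>O(1/n)\<close>. If \<open>W = 1/2\<close> almost everywhere, the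
  latent variables carry no information and distinct edges are independent, so only the
  \<open>O(n\<^sup>6)\<close> pairs with two common vertices matter and the variance is
  \<open>O(1/n\<^sup>2)\<close>, which is the scale of the first claim.

  Since \<open>W\<close> is only Lebesgue measurable, it is first replaced by a Borel kernel that agrees
  with it almost everywhere (\<open>tournamenton_AE_kernel\<close>). This changes neither the law of the
  random tournament nor \<open>t(Tr\<^sub>4, W)\<close>.\<close>

section \<open>Symmetrisation of the transitive pattern\<close>

definition tr4 :: "('v \<Rightarrow> 'v \<Rightarrow> real) \<Rightarrow> 'v \<Rightarrow> 'v \<Rightarrow> 'v \<Rightarrow> 'v \<Rightarrow> real" where
  "tr4 w a b c d = w a b * w a c * w a d * w b c * w b d * w c d"

lemma tr4_half:
  assumes w: "\<forall>u\<in>S. \<forall>v\<in>S. u \<noteq> v \<longrightarrow> w u v = 1 / 2"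
    and s: "{a, b, c, d} \<subseteq> S" "distinct [a, b, c, d]"
  shows "tr4 w a b c d = 1 / 64"
proof -
  have "w a b = 1 / 2" "w a c = 1 / 2" "w a d = 1 / 2" "w b c = 1 / 2" "w b d = 1 / 2" "w c d = 1 / 2"
    using w s by auto
  then show ?thesis by (simp only: tr4_def)
qed

definition cherry :: "('v \<Rightarrow> 'v \<Rightarrow> real) \<Rightarrow> 'v \<Rightarrow> 'v \<Rightarrow> 'v \<Rightarrow> real" where
  "cherry f c u v = f c u * f c v"

definition cycle4 :: "('v \<Rightarrow> 'v \<Rightarrow> real) \<Rightarrow> 'v \<Rightarrow> 'v \<Rightarrow> 'v \<Rightarrow> 'v \<Rightarrow> real" where
  "cycle4 f a b c d = f a b * f b c * f c d * f d a"

text \<open>The six transitive orderings of \<open>{s, a, b, c}\<close> that start at the source \<open>s\<close>.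
  Splitting the \<open>24\<close> orderings by their source keeps the polynomial identities small.\<close>

definition tr4_source :: "('v \<Rightarrow> 'v \<Rightarrow> real) \<Rightarrow> 'v \<Rightarrow> 'v \<Rightarrow> 'v \<Rightarrow> 'v \<Rightarrow> real" where
  "tr4_source w s a b c = tr4 w s a b c + tr4 w s a c b + tr4 w s b a c
     + tr4 w s b c a + tr4 w s c a b + tr4 w s c b a"

text \<open>Once the source has beaten the other three vertices, these must span a transitive triangle. The two
  cyclic triangles have total weight \<open>1/4 + f a b * f b c + f b c * f c a + f c a * f a b\<close>,
  and the transitive ones have the complementary weight; by antisymmetry each product
  is the negative of a cherry.\<close>

lemma tr4_source_expand:
  assumes w: "\<And>u v. w u v = 1/2 + f u v" and f: "\<And>u v. f v u = - f u v"
  shows "tr4_source w s a b c =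
    (1/2 + f s a) * (1/2 + f s b) * (1/2 + f s c) *
    (3/4 + cherry f b a c + cherry f c a b + cherry f a b c)"
proof -
  have "tr4_source w s a b c = (w s a * w s b * w s c) *
    (w a b * w a c * w b c + w a c * w a b * w c b + w b a * w b c * w a c
     + w b c * w b a * w c a + w c a * w c b * w a b + w c b * w c a * w b a)"
    unfolding tr4_source_def tr4_def by (simp add: algebra_simps)
  also have "(w a b * w a c * w b c + w a c * w a b * w c b + w b a * w b c * w a c
     + w b c * w b a * w c a + w c a * w c b * w a b + w c b * w c a * w b a)
     = 3/4 + cherry f b a c + cherry f c a b + cherry f a b c"
    unfolding cherry_def w f[of a b] f[of a c] f[of b c] by (simp add: field_simps)
  finally show ?thesis unfolding w[of s a] w[of s b] w[of s c] .
qed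

text \<open>The twelve cherries and the three four-cycles of \<open>K\<^sub>4\<close> are the only monomials
  that survive. Each of them integrates to a nonnegative number, which is why
  \<open>1/64\<close> is a minimum.\<close>

lemma tr4_symmetrisation:
  assumes w: "\<And>u v. w u v = 1/2 + f u v" and f: "\<And>u v. f v u = - f u v"
  shows "tr4_source w a b c d + tr4_source w b a c d + tr4_source w c a b d + tr4_source w d a b c =
    3/8 + 1/2 * (cherry f a b c + cherry f a b d + cherry f a c d
               + cherry f b a c + cherry f b a d + cherry f b c d
               + cherry f c a b + cherry f c a d + cherry f c b d
               + cherry f d a b + cherry f d a c + cherry f d b c)
      + 2 * (cycle4 f a b c d + cycle4 f a b d c + cycle4 f a c b d)"
  unfolding tr4_source_expand[OF w f] cherry_def cycle4_def
    f[of a b] f[of a c] f[of a d] f[of b c] f[of b d] f[of c d]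
  by (simp add: field_simps)

section \<open>Coordinates of independent uniform variables\<close>

abbreviation unif :: "real measure" where
  "unif \<equiv> uniform_measure lborel {0..1}"

lemma prob_space_unif: "prob_space unif"
  by (rule prob_space_uniform_measure) auto

interpretation unif: prob_space unif
  by (rule prob_space_unif)

abbreviation unif_prod :: "nat set \<Rightarrow> (nat \<Rightarrow> real) measure" where
  "unif_prod K \<equiv> \<Pi>\<^sub>M i\<in>K. unif"

interpretation unif_prod: prob_space "unif_prod K" for K
  by (intro prob_space_PiM prob_space_unif)

lemma indep_vars_coordinates:
  "prob_space.indep_vars (unif_prod K) (\<lambda>_. unif) (\<lambda>i \<eta>. \<eta> i) K"
proof (cases "K = {}")
  case True
  then show ?thesis by (simp add: unif_prod.indep_vars_def unif_prod.indep_sets_def)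
next
  case False
  have "distr (unif_prod K) (unif_prod K) (\<lambda>\<eta>. \<lambda>i\<in>K. \<eta> i) = distr (unif_prod K) (unif_prod K) (\<lambda>\<eta>. \<eta>)"
    by (rule distr_cong) (auto simp: space_PiM PiE_def extensional_restrict)
  also have "\<dots> = unif_prod K" by (simp add: distr_id)
  also have "\<dots> = (\<Pi>\<^sub>M i\<in>K. distr (unif_prod K) unif (\<lambda>\<eta>. \<eta> i))"
    by (intro PiM_cong refl distr_PiM_component[symmetric] prob_space_unif)
  finally show ?thesis
    using False by (subst unif_prod.indep_vars_iff_distr_eq_PiM') auto
qed

text \<open>Peeling off one coordinate at a time gives the joint law of any few distinct coordinates as an
  iterated binary product, the form in which Fubini's theorem applies. The second component is a
  general function \<open>Y\<close> of the remaining coordinates so that the step can be repeated.\<close>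

lemma distr_fresh_coordinate:
  assumes a: "a \<in> K" "a \<notin> B" and B: "B \<subseteq> K"
    and Y: "Y \<in> unif_prod B \<rightarrow>\<^sub>M N"
  shows "distr (unif_prod K) (unif \<Otimes>\<^sub>M N) (\<lambda>\<eta>. (\<eta> a, Y (restrict \<eta> B)))
       = unif \<Otimes>\<^sub>M distr (unif_prod K) N (\<lambda>\<eta>. Y (restrict \<eta> B))"
proof -
  have "unif_prod.indep_var K (unif_prod {a}) (\<lambda>\<eta>. restrict \<eta> {a}) (unif_prod B) (\<lambda>\<eta>. restrict \<eta> B)"
    using unif_prod.indep_var_restrict[OF indep_vars_coordinates, of "{a}" B K] a B by auto
  then have joint: "distr (unif_prod K) (unif_prod {a} \<Otimes>\<^sub>M unif_prod B) (\<lambda>\<eta>. (restrict \<eta> {a}, restrict \<eta> B))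
     = distr (unif_prod K) (unif_prod {a}) (\<lambda>\<eta>. restrict \<eta> {a}) \<Otimes>\<^sub>M
       distr (unif_prod K) (unif_prod B) (\<lambda>\<eta>. restrict \<eta> B)" (is "_ = ?L \<Otimes>\<^sub>M ?R")
    by (simp add: unif_prod.indep_var_distribution_eq)
  \<comment> \<open>Independence is available for the restrictions to \<open>{a}\<close> and \<open>B\<close>, whose values have the same
    type; the two components are read off afterwards.\<close>
  have ra: "(\<lambda>\<eta>. restrict \<eta> {a}) \<in> unif_prod K \<rightarrow>\<^sub>M unif_prod {a}"
    and rB: "(\<lambda>\<eta>. restrict \<eta> B) \<in> unif_prod K \<rightarrow>\<^sub>M unif_prod B"
    using a B by (auto intro: measurable_restrict_subset)
  have "distr (unif_prod K) (unif \<Otimes>\<^sub>M N) (\<lambda>\<eta>. (\<eta> a, Y (restrict \<eta> B)))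
      = distr (?L \<Otimes>\<^sub>M ?R) (unif \<Otimes>\<^sub>M N) (\<lambda>(x, y). (x a, Y y))"
    using Y ra rB by (subst joint[symmetric], subst distr_distr) (auto simp: comp_def)
  also have "\<dots> = distr ?L unif (\<lambda>x. x a) \<Otimes>\<^sub>M distr ?R N Y"
    using Y ra rB
    by (intro pair_measure_distr[symmetric] prob_space_imp_sigma_finite
          prob_space.prob_space_distr unif_prod.prob_space_distr) auto
  also have "distr ?L unif (\<lambda>x. x a) = distr (unif_prod K) unif (\<lambda>\<eta>. \<eta> a)"
    using ra by (subst distr_distr) (auto simp: comp_def)
  also have "\<dots> = unif"
    using distr_PiM_component[of K "\<lambda>_. unif" a] a prob_space_unif by simp
  also have "distr ?R N Y = distr (unif_prod K) N (\<lambda>\<eta>. Y (restrict \<eta> B))"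
    using Y rB by (subst distr_distr) (auto simp: comp_def)
  finally show ?thesis .
qed

lemma distr_two_coordinates:
  assumes "{a, b} \<subseteq> K" "a \<noteq> b"
  shows "distr (unif_prod K) (unif \<Otimes>\<^sub>M unif) (\<lambda>\<eta>. (\<eta> a, \<eta> b)) = unif \<Otimes>\<^sub>M unif"
  using distr_fresh_coordinate[of a K "{b}" "\<lambda>x. x b" unif] assms
    distr_PiM_component[of K "\<lambda>_. unif" b] prob_space_unif
  by simp

lemma AE_coordinate_pairs:
  assumes P: "AE p in unif \<Otimes>\<^sub>M unif. P (fst p) (snd p)" and K: "finite K"
  shows "AE \<eta> in unif_prod K. \<forall>u\<in>K. \<forall>v\<in>K. u \<noteq> v \<longrightarrow> P (\<eta> u) (\<eta> v)"
proof (intro AE_finite_allI K)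
  fix u v assume uv: "u \<in> K" "v \<in> K"
  show "AE \<eta> in unif_prod K. u \<noteq> v \<longrightarrow> P (\<eta> u) (\<eta> v)"
  proof (cases "u = v")
    case False
    with uv have "AE p in distr (unif_prod K) (unif \<Otimes>\<^sub>M unif) (\<lambda>\<eta>. (\<eta> u, \<eta> v)). P (fst p) (snd p)"
      by (subst distr_two_coordinates) (auto intro: P)
    from AE_distrD[OF _ this] uv show ?thesis by simp
  qed simp
qed

lemma distr_three_coordinates:
  assumes "{a, b, c} \<subseteq> K" "distinct [a, b, c]"
  shows "distr (unif_prod K) (unif \<Otimes>\<^sub>M unif \<Otimes>\<^sub>M unif) (\<lambda>\<eta>. (\<eta> a, \<eta> b, \<eta> c))
    = unif \<Otimes>\<^sub>M unif \<Otimes>\<^sub>M unif"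
  using distr_fresh_coordinate[of a K "{b, c}" "\<lambda>x. (x b, x c)" "unif \<Otimes>\<^sub>M unif"] assms
  by (simp add: distr_two_coordinates)

lemma distr_four_coordinates:
  assumes "{a, b, c, d} \<subseteq> K" "distinct [a, b, c, d]"
  shows "distr (unif_prod K) (unif \<Otimes>\<^sub>M unif \<Otimes>\<^sub>M unif \<Otimes>\<^sub>M unif) (\<lambda>\<eta>. (\<eta> a, \<eta> b, \<eta> c, \<eta> d))
    = unif \<Otimes>\<^sub>M unif \<Otimes>\<^sub>M unif \<Otimes>\<^sub>M unif"
  using distr_fresh_coordinate[of a K "{b, c, d}" "\<lambda>x. (x b, x c, x d)" "unif \<Otimes>\<^sub>M unif \<Otimes>\<^sub>M unif"] assms
  by (simp add: distr_three_coordinates)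

lemma integral_four_coordinates:
  fixes h :: "real \<times> real \<times> real \<times> real \<Rightarrow> real"
  assumes s: "{a, b, c, d} \<subseteq> K" "distinct [a, b, c, d]"
    and [measurable]: "h \<in> borel_measurable (borel \<Otimes>\<^sub>M borel \<Otimes>\<^sub>M borel \<Otimes>\<^sub>M borel)"
  shows "(\<integral>\<eta>. h (\<eta> a, \<eta> b, \<eta> c, \<eta> d) \<partial>unif_prod K) = integral\<^sup>L (unif \<Otimes>\<^sub>M unif \<Otimes>\<^sub>M unif \<Otimes>\<^sub>M unif) h"
  using s by (subst distr_four_coordinates[OF s, symmetric], subst integral_distr) auto

section \<open>Borel tournament kernels\<close>

text \<open>A tournamenton that is Borel measurable and satisfies the pointwise conditions on the whole plane,
  so that bounds and antisymmetry can be used at every point, without exceptional null sets.\<close>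

locale tournament_kernel =
  fixes V :: "real \<Rightarrow> real \<Rightarrow> real"
  assumes measurable_kernel [measurable]: "case_prod V \<in> borel_measurable (borel \<Otimes>\<^sub>M borel)"
    and kernel_nonneg: "0 \<le> V x y"
    and kernel_add_swap: "V x y + V y x = 1"
begin

lemma kernel_le_one: "V x y \<le> 1"
  using kernel_nonneg[of y x] kernel_add_swap[of x y] by linarith

definition density_tr4 :: real where
  "density_tr4 = (\<integral>(x1, x2, x3, x4). tr4 V x1 x2 x3 x4 \<partial>(unif \<Otimes>\<^sub>M unif \<Otimes>\<^sub>M unif \<Otimes>\<^sub>M unif))"

lemma tr4_kernel_measurable [measurable]:
  "(\<lambda>(x1, x2, x3, x4). tr4 V x1 x2 x3 x4) \<in> borel_measurable (borel \<Otimes>\<^sub>M borel \<Otimes>\<^sub>M borel \<Otimes>\<^sub>M borel)"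
  unfolding tr4_def by measurable

text \<open>The mean is the same for all quadruples of distinct coordinates. This serves both for the mean of
  the subgraph count and for symmetrising the density over the orderings of four points.\<close>

lemma expectation_tr4:
  assumes "{a, b, c, d} \<subseteq> K" "distinct [a, b, c, d]"
  shows "(\<integral>\<eta>. tr4 (\<lambda>u v. V (\<eta> u) (\<eta> v)) a b c d \<partial>unif_prod K) = density_tr4"
proof -
  have "(\<integral>\<eta>. tr4 (\<lambda>u v. V (\<eta> u) (\<eta> v)) a b c d \<partial>unif_prod K)
     = (\<integral>\<eta>. (\<lambda>(x1, x2, x3, x4). tr4 V x1 x2 x3 x4) (\<eta> a, \<eta> b, \<eta> c, \<eta> d) \<partial>unif_prod K)"
    by (simp add: tr4_def)
  also have "\<dots> = density_tr4"
    unfolding density_tr4_def by (rule integral_four_coordinates[OF assms]) measurable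
  finally show ?thesis .
qed

lemma kernel_coordinates_measurable [measurable]:
  "u \<in> K \<Longrightarrow> v \<in> K \<Longrightarrow> (\<lambda>\<eta>. V (\<eta> u) (\<eta> v)) \<in> borel_measurable (unif_prod K)"
  by measurable

lemma tr4_bounds: "0 \<le> tr4 (\<lambda>u v. V (\<eta> u) (\<eta> v)) a b c d" "tr4 (\<lambda>u v. V (\<eta> u) (\<eta> v)) a b c d \<le> 1"
  unfolding tr4_def by (auto intro!: mult_nonneg_nonneg mult_le_one kernel_nonneg kernel_le_one)

lemma tr4_coordinates_measurable [measurable]:
  "{a, b, c, d} \<subseteq> K \<Longrightarrow> (\<lambda>\<eta>. tr4 (\<lambda>u v. V (\<eta> u) (\<eta> v)) a b c d) \<in> borel_measurable (unif_prod K)"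
  unfolding tr4_def by measurable auto

lemma integrable_tr4:
  assumes "{a, b, c, d} \<subseteq> K"
  shows "integrable (unif_prod K) (\<lambda>\<eta>. tr4 (\<lambda>u v. V (\<eta> u) (\<eta> v)) a b c d)"
  using assms
  by (intro unif_prod.integrable_const_bound[where B = 1] tr4_coordinates_measurable)
     (auto simp: abs_of_nonneg tr4_bounds)

lemma expectation_tr4_disjoint:
  assumes s: "{a, b, c, d} \<subseteq> K" "distinct [a, b, c, d]"
    and s': "{a', b', c', d'} \<subseteq> K" "distinct [a', b', c', d']"
    and disj: "{a, b, c, d} \<inter> {a', b', c', d'} = {}"
  shows "(\<integral>\<eta>. tr4 (\<lambda>u v. V (\<eta> u) (\<eta> v)) a b c d * tr4 (\<lambda>u v. V (\<eta> u) (\<eta> v)) a' b' c' d' \<partial>unif_prod K)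
     = density_tr4\<^sup>2"
proof -
  let ?S = "{a, b, c, d}" and ?S' = "{a', b', c', d'}"
  have "unif_prod.indep_var K (unif_prod ?S) (\<lambda>\<eta>. restrict \<eta> ?S) (unif_prod ?S') (\<lambda>\<eta>. restrict \<eta> ?S')"
    by (rule unif_prod.indep_var_restrict[OF indep_vars_coordinates disj s(1) s'(1)])
  then have "unif_prod.indep_var K borel ((\<lambda>\<eta>. tr4 (\<lambda>u v. V (\<eta> u) (\<eta> v)) a b c d) \<circ> (\<lambda>\<eta>. restrict \<eta> ?S))
     borel ((\<lambda>\<eta>. tr4 (\<lambda>u v. V (\<eta> u) (\<eta> v)) a' b' c' d') \<circ> (\<lambda>\<eta>. restrict \<eta> ?S'))"
    by (rule unif_prod.indep_var_compose) (auto intro!: tr4_coordinates_measurable)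
  then have "unif_prod.indep_var K borel (\<lambda>\<eta>. tr4 (\<lambda>u v. V (\<eta> u) (\<eta> v)) a b c d)
     borel (\<lambda>\<eta>. tr4 (\<lambda>u v. V (\<eta> u) (\<eta> v)) a' b' c' d')"
    by (simp add: comp_def tr4_def)
  then have "(\<integral>\<eta>. tr4 (\<lambda>u v. V (\<eta> u) (\<eta> v)) a b c d * tr4 (\<lambda>u v. V (\<eta> u) (\<eta> v)) a' b' c' d' \<partial>unif_prod K)
     = (\<integral>\<eta>. tr4 (\<lambda>u v. V (\<eta> u) (\<eta> v)) a b c d \<partial>unif_prod K)
     * (\<integral>\<eta>. tr4 (\<lambda>u v. V (\<eta> u) (\<eta> v)) a' b' c' d' \<partial>unif_prod K)"
    by (rule unif_prod.indep_var_lebesgue_integral) (intro integrable_tr4 s s')+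
  then show ?thesis
    by (simp only: expectation_tr4[OF s] expectation_tr4[OF s'] power2_eq_square)
qed

end

section \<open>The transitive density attains 1/64 only at the constant kernel\<close>

lemma integral_prod_bounded:
  fixes h :: "'a \<times> 'b \<Rightarrow> real"
  assumes M: "prob_space M" and N: "prob_space N"
    and [measurable]: "h \<in> borel_measurable (M \<Otimes>\<^sub>M N)"
    and h: "\<And>x y. \<bar>h (x, y)\<bar> \<le> B"
  shows "integral\<^sup>L (M \<Otimes>\<^sub>M N) h = (\<integral>x. \<integral>y. h (x, y) \<partial>N \<partial>M)"
proof -
  interpret pair_prob_space M N
    using M N by (simp add: pair_prob_space_def pair_sigma_finite_def prob_space_imp_sigma_finite)
  have "integrable (M \<Otimes>\<^sub>M N) h"
    by (rule P.integrable_const_bound[where B = B]) (auto intro!: AE_I2 h simp: split_paired_all)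
  then show ?thesis
    by (simp add: integral_fst')
qed

lemma integral_mult_iterated:
  fixes g :: "'a \<Rightarrow> real" and h :: "'b \<Rightarrow> real"
  shows "(\<integral>x. \<integral>y. g x * h y \<partial>N \<partial>M) = integral\<^sup>L M g * integral\<^sup>L N h"
  by simp

lemma prob_space_unif2: "prob_space (unif \<Otimes>\<^sub>M unif)"
  by (intro prob_space_pair prob_space_unif)

lemma prob_space_unif3: "prob_space (unif \<Otimes>\<^sub>M unif \<Otimes>\<^sub>M unif)"
  by (intro prob_space_pair prob_space_unif)

interpretation unif2: prob_space "unif \<Otimes>\<^sub>M unif"
  by (rule prob_space_unif2)

context tournament_kernel
begin

definition dev :: "real \<Rightarrow> real \<Rightarrow> real" where
  "dev x y = V x y - 1 / 2"

lemma dev_measurable [measurable]: "case_prod dev \<in> borel_measurable (borel \<Otimes>\<^sub>M borel)"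
  unfolding dev_def by measurable

lemma dev_swap: "dev y x = - dev x y"
  using kernel_add_swap[of x y] by (simp add: dev_def)

lemma abs_dev_le: "\<bar>dev x y\<bar> \<le> 1"
  using kernel_nonneg[of x y] kernel_le_one[of x y] by (simp add: dev_def)

lemma abs_dev_mult_le: "\<bar>dev x y * t\<bar> \<le> 1" if "\<bar>t\<bar> \<le> 1"
  using that abs_dev_le[of x y] by (simp add: abs_mult mult_le_one)

text \<open>The composition of the kernel \<open>dev\<close> with itself. Antisymmetry of \<open>dev\<close> makes it
  symmetric, so the factors \<open>dev_comp x z\<close> and \<open>dev_comp z x\<close> that arise from a
  four-cycle form a square.\<close>

definition dev_comp :: "real \<Rightarrow> real \<Rightarrow> real" where
  "dev_comp x z = (\<integral>y. dev x y * dev y z \<partial>unif)"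

lemma dev_comp_measurable [measurable]: "case_prod dev_comp \<in> borel_measurable (borel \<Otimes>\<^sub>M borel)"
  unfolding dev_comp_def by measurable

lemma abs_dev_comp_le: "\<bar>dev_comp x z\<bar> \<le> 1"
proof -
  have "\<bar>dev_comp x z\<bar> \<le> (\<integral>y. 1 \<partial>unif)"
    unfolding dev_comp_def
    by (rule integral_abs_bound_integral)
       (auto intro!: unif.integrable_const_bound[where B = 1] AE_I2 abs_dev_mult_le abs_dev_le)
  then show ?thesis by (simp add: unif.prob_space)
qed

lemma dev_comp_sym: "dev_comp z x = dev_comp x z"
  unfolding dev_comp_def by (rule Bochner_Integration.integral_cong) (auto simp: dev_swap[of z] dev_swap[of _ x])

text \<open>Given the centre of the cherry its two ends are independent with the same law, hence the square.\<close>

lemma expectation_cherry: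
  assumes "{c, u, v} \<subseteq> K" "distinct [c, u, v]"
  shows "(\<integral>\<eta>. cherry (\<lambda>u v. dev (\<eta> u) (\<eta> v)) c u v \<partial>unif_prod K) = (\<integral>x. (\<integral>y. dev x y \<partial>unif)\<^sup>2 \<partial>unif)"
proof -
  have "(\<integral>\<eta>. cherry (\<lambda>u v. dev (\<eta> u) (\<eta> v)) c u v \<partial>unif_prod K)
     = (\<integral>\<eta>. (\<lambda>(x, y, z). dev x y * dev x z) (\<eta> c, \<eta> u, \<eta> v) \<partial>unif_prod K)"
    by (simp add: cherry_def)
  also have "\<dots> = (\<integral>(x, y, z). dev x y * dev x z \<partial>(unif \<Otimes>\<^sub>M unif \<Otimes>\<^sub>M unif))"
    using assms by (subst distr_three_coordinates[OF assms, symmetric], subst integral_distr) auto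
  also have "\<dots> = (\<integral>x. \<integral>p. dev x (fst p) * dev x (snd p) \<partial>(unif \<Otimes>\<^sub>M unif) \<partial>unif)"
    by (subst integral_prod_bounded[OF prob_space_unif prob_space_unif2, where B = 1])
       (auto intro!: abs_dev_mult_le abs_dev_le simp: case_prod_beta)
  also have "\<dots> = (\<integral>x. \<integral>y. \<integral>z. dev x y * dev x z \<partial>unif \<partial>unif \<partial>unif)"
    by (subst integral_prod_bounded[OF prob_space_unif prob_space_unif, where B = 1])
       (auto intro!: abs_dev_mult_le abs_dev_le)
  finally show ?thesis by (simp add: power2_eq_square)
qed

text \<open>Given two opposite vertices \<open>x\<close> and \<open>z\<close> of the cycle, the other two are independent, and each contributes
  \<open>dev_comp x z\<close>.\<close>

lemma expectation_cycle4:
  assumes "{a, b, c, d} \<subseteq> K" "distinct [a, b, c, d]"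
  shows "(\<integral>\<eta>. cycle4 (\<lambda>u v. dev (\<eta> u) (\<eta> v)) a b c d \<partial>unif_prod K)
    = (\<integral>(x, z). (dev_comp x z)\<^sup>2 \<partial>(unif \<Otimes>\<^sub>M unif))"
proof -
  have "(\<integral>\<eta>. cycle4 (\<lambda>u v. dev (\<eta> u) (\<eta> v)) a b c d \<partial>unif_prod K)
     = (\<integral>\<eta>. (\<lambda>(x, z, y, t). dev x y * (dev y z * (dev z t * dev t x))) (\<eta> a, \<eta> c, \<eta> b, \<eta> d) \<partial>unif_prod K)"
    \<comment> \<open>The coordinates are reordered so that the opposite vertices are integrated last.\<close>
    by (simp add: cycle4_def mult.assoc)
  also have "\<dots> = (\<integral>(x, z, y, t). dev x y * (dev y z * (dev z t * dev t x))
      \<partial>(unif \<Otimes>\<^sub>M unif \<Otimes>\<^sub>M unif \<Otimes>\<^sub>M unif))"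
    using assms by (intro integral_four_coordinates) auto
  also have "\<dots> = (\<integral>x. \<integral>q. dev x (fst (snd q)) * (dev (fst (snd q)) (fst q) *
      (dev (fst q) (snd (snd q)) * dev (snd (snd q)) x)) \<partial>(unif \<Otimes>\<^sub>M unif \<Otimes>\<^sub>M unif) \<partial>unif)"
    by (subst integral_prod_bounded[OF prob_space_unif prob_space_unif3, where B = 1])
       (auto intro!: abs_dev_mult_le abs_dev_le simp: case_prod_beta)
  also have "\<dots> = (\<integral>x. \<integral>z. \<integral>q. dev x (fst q) * (dev (fst q) z * (dev z (snd q) * dev (snd q) x))
      \<partial>(unif \<Otimes>\<^sub>M unif) \<partial>unif \<partial>unif)"
    by (subst integral_prod_bounded[OF prob_space_unif prob_space_unif2, where B = 1])
       (auto intro!: abs_dev_mult_le abs_dev_le)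
  also have "\<dots> = (\<integral>x. \<integral>z. \<integral>y. \<integral>t. dev x y * (dev y z * (dev z t * dev t x)) \<partial>unif \<partial>unif \<partial>unif \<partial>unif)"
    by (subst integral_prod_bounded[OF prob_space_unif prob_space_unif, where B = 1])
       (auto intro!: abs_dev_mult_le abs_dev_le)
  also have "\<dots> = (\<integral>x. \<integral>z. dev_comp x z * dev_comp z x \<partial>unif \<partial>unif)"
    using integral_mult_iterated[of unif unif "\<lambda>y. dev x y * dev y z" "\<lambda>t. dev z t * dev t x" for x z]
    by (simp add: dev_comp_def mult.assoc)
  also have "\<dots> = (\<integral>x. \<integral>z. (dev_comp x z)\<^sup>2 \<partial>unif \<partial>unif)"
    by (simp add: dev_comp_sym power2_eq_square)
  also have "\<dots> = (\<integral>(x, z). (dev_comp x z)\<^sup>2 \<partial>(unif \<Otimes>\<^sub>M unif))"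
    by (subst integral_prod_bounded[OF prob_space_unif prob_space_unif, where B = 1])
       (auto simp: abs_square_le_1 abs_dev_comp_le)
  finally show ?thesis .
qed

lemma integrable_cherry:
  assumes "{c, u, v} \<subseteq> K"
  shows "integrable (unif_prod K) (\<lambda>\<eta>. cherry (\<lambda>u v. dev (\<eta> u) (\<eta> v)) c u v)"
  using assms unfolding cherry_def
  by (intro unif_prod.integrable_const_bound[where B = 1])
     (auto intro!: AE_I2 abs_dev_mult_le abs_dev_le)

lemma integrable_cycle4:
  assumes "{a, b, c, d} \<subseteq> K"
  shows "integrable (unif_prod K) (\<lambda>\<eta>. cycle4 (\<lambda>u v. dev (\<eta> u) (\<eta> v)) a b c d)"
  using assms unfolding cycle4_def mult.assoc
  by (intro unif_prod.integrable_const_bound[where B = 1])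
     (auto intro!: AE_I2 abs_dev_mult_le abs_dev_le)

lemma density_tr4_expansion:
  "density_tr4 = 1 / 64 + 1 / 4 * (\<integral>x. (\<integral>y. dev x y \<partial>unif)\<^sup>2 \<partial>unif)
     + 1 / 4 * (\<integral>(x, z). (dev_comp x z)\<^sup>2 \<partial>(unif \<Otimes>\<^sub>M unif))"
    (is "_ = _ + _ * ?cherry + _ * ?cycle")
proof -
  let ?K = "{0, 1, 2, 3 :: nat}"
  let ?w = "\<lambda>\<eta> u v. V (\<eta> u) (\<eta> v) :: real" and ?f = "\<lambda>\<eta> u v. dev (\<eta> u) (\<eta> v) :: real"
  have source: "(\<integral>\<eta>. tr4_source (?w \<eta>) s a b c \<partial>unif_prod ?K) = 6 * density_tr4"
      "integrable (unif_prod ?K) (\<lambda>\<eta>. tr4_source (?w \<eta>) s a b c)"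
    if "{s, a, b, c} \<subseteq> ?K" "distinct [s, a, b, c]" for s a b c
    unfolding tr4_source_def using that by (simp_all add: expectation_tr4 integrable_tr4)
  note [simp del] = One_nat_def
  have "(\<integral>\<eta>. tr4_source (?w \<eta>) 0 1 2 3 + tr4_source (?w \<eta>) 1 0 2 3
      + tr4_source (?w \<eta>) 2 0 1 3 + tr4_source (?w \<eta>) 3 0 1 2 \<partial>unif_prod ?K) = 24 * density_tr4"
    by (simp add: source)
  also have "(\<lambda>\<eta>. tr4_source (?w \<eta>) 0 1 2 3 + tr4_source (?w \<eta>) 1 0 2 3
      + tr4_source (?w \<eta>) 2 0 1 3 + tr4_source (?w \<eta>) 3 0 1 2) =
    (\<lambda>\<eta>. 3/8 + 1/2 * (cherry (?f \<eta>) 0 1 2 + cherry (?f \<eta>) 0 1 3 + cherry (?f \<eta>) 0 2 3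
               + cherry (?f \<eta>) 1 0 2 + cherry (?f \<eta>) 1 0 3 + cherry (?f \<eta>) 1 2 3
               + cherry (?f \<eta>) 2 0 1 + cherry (?f \<eta>) 2 0 3 + cherry (?f \<eta>) 2 1 3
               + cherry (?f \<eta>) 3 0 1 + cherry (?f \<eta>) 3 0 2 + cherry (?f \<eta>) 3 1 2)
      + 2 * (cycle4 (?f \<eta>) 0 1 2 3 + cycle4 (?f \<eta>) 0 1 3 2 + cycle4 (?f \<eta>) 0 2 1 3))" (is "_ = ?total")
    by (rule ext, rule tr4_symmetrisation) (simp add: dev_def, rule dev_swap)
  finally have "24 * density_tr4 = integral\<^sup>L (unif_prod ?K) (?total :: _ \<Rightarrow> real)"
    by (rule sym)
  also have "\<dots> = 3/8 + 6 * ?cherry + 6 * ?cycle"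
    by (simp add: integrable_cherry integrable_cycle4 expectation_cherry expectation_cycle4 unif_prod.prob_space)
  finally show ?thesis by simp
qed

text \<open>With \<open>g y = \<integral>x. indicator A x * dev x y\<close>, expanding the square and exchanging the integrals
  turns \<open>\<integral> g\<^sup>2\<close> into minus the integral of \<open>dev_comp\<close> over \<open>A \<times> A\<close>.\<close>

lemma dev_comp_zero_imp_marginal_zero:
  assumes K: "AE p in unif \<Otimes>\<^sub>M unif. dev_comp (fst p) (snd p) = 0"
    and [measurable]: "A \<in> sets borel"
  shows "AE y in unif. (\<integral>x. indicator A x * dev x y \<partial>unif) = 0"
proof -
  define g where "g y = (\<integral>x. indicator A x * dev x y \<partial>unif)" for y
  have [measurable]: "g \<in> borel_measurable borel"
    unfolding g_def by measurable
  have ind: "\<bar>indicator A x * t\<bar> \<le> 1" if "\<bar>t\<bar> \<le> 1" for x and t :: real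
    using that by (auto simp: indicator_def)
  have g1: "\<bar>g y\<bar> \<le> 1" for y
  proof -
    have "\<bar>g y\<bar> \<le> (\<integral>x. 1 \<partial>unif)" unfolding g_def
      by (rule integral_abs_bound_integral)
         (auto intro!: unif.integrable_const_bound[where B = 1] AE_I2 ind abs_dev_le)
    then show ?thesis by (simp add: unif.prob_space)
  qed
  have "(\<integral>y. (g y)\<^sup>2 \<partial>unif) = (\<integral>y. \<integral>x. \<integral>z. indicator A x * (dev x y * (indicator A z * dev z y)) \<partial>unif \<partial>unif \<partial>unif)"
    using integral_mult_iterated[of unif unif "\<lambda>x. indicator A x * dev x y" "\<lambda>z. indicator A z * dev z y" for y]
    by (simp add: g_def power2_eq_square mult.assoc)
  also have "\<dots> = (\<integral>y. \<integral>(x, z). indicator A x * (dev x y * (indicator A z * dev z y)) \<partial>(unif \<Otimes>\<^sub>M unif) \<partial>unif)"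
    by (subst integral_prod_bounded[OF prob_space_unif prob_space_unif, where B = 1])
       (auto intro!: abs_dev_mult_le abs_dev_le ind)
  also have "\<dots> = (\<integral>(x, z). \<integral>y. indicator A x * (dev x y * (indicator A z * dev z y)) \<partial>unif \<partial>(unif \<Otimes>\<^sub>M unif))"
  proof -
    interpret P: pair_prob_space unif "unif \<Otimes>\<^sub>M unif"
      by (simp add: pair_prob_space_def pair_sigma_finite_def prob_space_imp_sigma_finite prob_space_unif prob_space_unif2)
    have "integrable (unif \<Otimes>\<^sub>M unif \<Otimes>\<^sub>M unif)
       (\<lambda>(y, p). case p of (x, z) \<Rightarrow> indicator A x * (dev x y * (indicator A z * dev z y)))"
      by (rule P.P.integrable_const_bound[where B = 1])
         (auto intro!: AE_I2 abs_dev_mult_le abs_dev_le ind)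
    from P.Fubini_integral[OF this] show ?thesis by (simp only: split_def fst_conv snd_conv)
  qed
  also have "\<dots> = (\<integral>p. - (indicator A (fst p) * indicator A (snd p)) * dev_comp (fst p) (snd p) \<partial>(unif \<Otimes>\<^sub>M unif))"
    unfolding dev_comp_def Bochner_Integration.integral_mult_right_zero[symmetric]
    by (auto intro!: Bochner_Integration.integral_cong simp: dev_swap[of _ "snd _"] case_prod_beta mult_ac)
  also have "\<dots> = (\<integral>p. 0 \<partial>(unif \<Otimes>\<^sub>M unif))"
    using K by (intro integral_cong_AE) auto
  finally have "(\<integral>y. (g y)\<^sup>2 \<partial>unif) = 0" by simp
  moreover have "integrable unif (\<lambda>y. (g y)\<^sup>2)"
    by (rule unif.integrable_const_bound[where B = 1]) (auto simp: abs_square_le_1 g1)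
  ultimately have "AE y in unif. (g y)\<^sup>2 = 0"
    by (subst (asm) integral_nonneg_eq_0_iff_AE) auto
  then show ?thesis by (simp add: g_def)
qed

text \<open>The deviation now integrates to zero over every rectangle. Therefore the measure with density
  \<open>2 V\<close> agrees with the uniform measure on rectangles, so the two measures coincide and
  \<open>2 V = 1\<close> almost everywhere.\<close>

lemma dev_comp_zero_imp_kernel_half:
  assumes K: "AE p in unif \<Otimes>\<^sub>M unif. dev_comp (fst p) (snd p) = 0"
  shows "AE p in unif \<Otimes>\<^sub>M unif. V (fst p) (snd p) = 1 / 2"
proof -
  let ?N = "density (unif \<Otimes>\<^sub>M unif) (\<lambda>p. ennreal (2 * V (fst p) (snd p)))"
  have eq: "unif \<Otimes>\<^sub>M unif = ?N"
  proof (rule pair_measure_eqI)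
    fix A B assume "A \<in> sets unif" "B \<in> sets unif"
    then have [measurable]: "A \<in> sets borel" "B \<in> sets borel" by auto
    let ?R = "\<lambda>p. indicator A (fst p) * indicator B (snd p) :: real"
    have F2: "\<bar>indicator B y * (indicator A x * dev x y)\<bar> \<le> 1" for x y
      using abs_dev_le[of x y] by (auto simp: indicator_def)
    have "(\<integral>p. ?R p * dev (fst p) (snd p) \<partial>(unif \<Otimes>\<^sub>M unif)) = 0"
    proof -
      interpret P: pair_prob_space unif unif
        by (simp add: pair_prob_space_def pair_sigma_finite_def prob_space_imp_sigma_finite prob_space_unif)
      have int: "integrable (unif \<Otimes>\<^sub>M unif) (\<lambda>(x, y). indicator B y * (indicator A x * dev x y))"
        by (rule unif2.integrable_const_bound[where B = 1]) (auto intro!: AE_I2 simp: F2)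
      have "(\<integral>p. ?R p * dev (fst p) (snd p) \<partial>(unif \<Otimes>\<^sub>M unif))
         = (\<integral>(x, y). indicator B y * (indicator A x * dev x y) \<partial>(unif \<Otimes>\<^sub>M unif))"
        by (rule Bochner_Integration.integral_cong) (auto simp: mult_ac)
      also have "\<dots> = (\<integral>y. indicator B y * (\<integral>x. indicator A x * dev x y \<partial>unif) \<partial>unif)"
        by (subst P.integral_snd[OF int, symmetric]) simp
      also have "\<dots> = (\<integral>y. 0 \<partial>unif)"
        using dev_comp_zero_imp_marginal_zero[OF K, of A] by (intro integral_cong_AE) auto
      finally show ?thesis by simp
    qed
    moreover have "integrable (unif \<Otimes>\<^sub>M unif) ?R"
      by (rule unif2.integrable_const_bound[where B = 1]) (auto simp: indicator_def)
    moreover have "integrable (unif \<Otimes>\<^sub>M unif) (\<lambda>p. ?R p * dev (fst p) (snd p))"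
      by (rule unif2.integrable_const_bound[where B = 1]) (auto simp: indicator_def abs_dev_le)
    moreover have "(\<lambda>p. ?R p * (2 * V (fst p) (snd p))) = (\<lambda>p. ?R p + 2 * (?R p * dev (fst p) (snd p)))"
      by (auto simp: dev_def field_simps)
    ultimately have int: "(\<integral>p. ?R p * (2 * V (fst p) (snd p)) \<partial>(unif \<Otimes>\<^sub>M unif)) = (\<integral>p. ?R p \<partial>(unif \<Otimes>\<^sub>M unif))"
      and intR: "integrable (unif \<Otimes>\<^sub>M unif) (\<lambda>p. ?R p * (2 * V (fst p) (snd p)))"
      by auto
    have "emeasure ?N (A \<times> B) = (\<integral>\<^sup>+p. ennreal (?R p * (2 * V (fst p) (snd p))) \<partial>(unif \<Otimes>\<^sub>M unif))"
      by (subst emeasure_density) (auto intro!: nn_integral_cong simp: indicator_def)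
    also have "\<dots> = ennreal (\<integral>p. ?R p * (2 * V (fst p) (snd p)) \<partial>(unif \<Otimes>\<^sub>M unif))"
      by (rule nn_integral_eq_integral[OF intR]) (auto simp: kernel_nonneg)
    also have "\<dots> = ennreal (\<integral>p. indicator (A \<times> B) p \<partial>(unif \<Otimes>\<^sub>M unif))"
      unfolding int by (intro arg_cong[where f = ennreal] Bochner_Integration.integral_cong)
        (auto simp: indicator_def)
    also have "\<dots> = emeasure (unif \<Otimes>\<^sub>M unif) (A \<times> B)"
      by (simp add: unif2.emeasure_eq_measure)
    also have "\<dots> = emeasure unif A * emeasure unif B"
      by (rule unif.emeasure_pair_measure_Times) auto
    finally show "emeasure unif A * emeasure unif B = emeasure ?N (A \<times> B)" by simp
  qed (auto intro: prob_space_imp_sigma_finite prob_space_unif)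
  have "AE p in unif \<Otimes>\<^sub>M unif. ennreal (2 * V (fst p) (snd p)) = 1"
  proof (rule unif2.density_unique_finite_measure)
    fix A assume A: "A \<in> sets (unif \<Otimes>\<^sub>M unif)"
    then have "emeasure ?N A = emeasure (unif \<Otimes>\<^sub>M unif) A" using eq by simp
    then show "(\<integral>\<^sup>+p. ennreal (2 * V (fst p) (snd p)) * indicator A p \<partial>(unif \<Otimes>\<^sub>M unif))
       = (\<integral>\<^sup>+p. 1 * indicator A p \<partial>(unif \<Otimes>\<^sub>M unif))"
      using A by (simp add: emeasure_density)
  qed auto
  then show ?thesis
    by eventually_elim (auto simp: kernel_nonneg)
qed

lemma AE_tr4_half:
  assumes half: "AE p in unif \<Otimes>\<^sub>M unif. V (fst p) (snd p) = 1 / 2"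
    and K: "finite K" and s: "{a, b, c, d} \<subseteq> K" "distinct [a, b, c, d]"
  shows "AE \<eta> in unif_prod K. tr4 (\<lambda>u v. V (\<eta> u) (\<eta> v)) a b c d = 1 / 64"
  using AE_coordinate_pairs[OF half K]
proof eventually_elim
  case (elim \<eta>)
  show ?case by (rule tr4_half[OF elim s])
qed

text \<open>Quasirandomness is forced by the density of \<open>Tr\<^sub>4\<close>: both correction terms of the
  expansion are nonnegative, so the value \<open>1/64\<close> makes the second one vanish.\<close>

theorem density_tr4_eq_iff:
  "density_tr4 = 1 / 64 \<longleftrightarrow> (AE p in unif \<Otimes>\<^sub>M unif. V (fst p) (snd p) = 1 / 2)"
proof
  assume *: "density_tr4 = 1 / 64"
  have "0 \<le> (\<integral>x. (\<integral>y. dev x y \<partial>unif)\<^sup>2 \<partial>unif)" "0 \<le> (\<integral>(x, z). (dev_comp x z)\<^sup>2 \<partial>(unif \<Otimes>\<^sub>M unif))"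
    by (auto intro!: Bochner_Integration.integral_nonneg)
  with * density_tr4_expansion have "(\<integral>(x, z). (dev_comp x z)\<^sup>2 \<partial>(unif \<Otimes>\<^sub>M unif)) = 0"
    by linarith
  moreover have "integrable (unif \<Otimes>\<^sub>M unif) (\<lambda>(x, z). (dev_comp x z)\<^sup>2)"
    by (rule unif2.integrable_const_bound[where B = 1]) (auto simp: abs_square_le_1 abs_dev_comp_le)
  ultimately have "AE p in unif \<Otimes>\<^sub>M unif. dev_comp (fst p) (snd p) = 0"
    by (subst (asm) integral_nonneg_eq_0_iff_AE) (auto simp: case_prod_beta)
  then show "AE p in unif \<Otimes>\<^sub>M unif. V (fst p) (snd p) = 1 / 2"
    by (rule dev_comp_zero_imp_kernel_half)
next
  assume *: "AE p in unif \<Otimes>\<^sub>M unif. V (fst p) (snd p) = 1 / 2"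
  let ?K = "{0, 1, 2, 3 :: nat}"
  have "AE \<eta> in unif_prod ?K. tr4 (\<lambda>u v. V (\<eta> u) (\<eta> v)) 0 1 2 3 = 1 / 64"
    by (rule AE_tr4_half[OF *]) auto
  then have "(\<integral>\<eta>. tr4 (\<lambda>u v. V (\<eta> u) (\<eta> v)) 0 1 2 3 \<partial>unif_prod ?K) = (\<integral>\<eta>. 1 / 64 \<partial>unif_prod ?K)"
    by (intro integral_cong_AE tr4_coordinates_measurable) auto
  then show "density_tr4 = 1 / 64"
    by (subst (asm) expectation_tr4) (auto simp: unif_prod.prob_space)
qed

end

section \<open>Borel representatives of tournamentons\<close>

lemma measurable_completion_AE_eq:
  assumes f: "f \<in> M \<rightarrow>\<^sub>M N" and eq: "AE x in M. f x = g x"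
    and g: "g \<in> space M \<rightarrow> space N"
  shows "g \<in> completion M \<rightarrow>\<^sub>M N"
proof (rule measurableI)
  fix A assume A: "A \<in> sets N"
  show "g -` A \<inter> space (completion M) \<in> sets (completion M)"
  proof (rule completion.in_sets_AE)
    show "AE x in completion M. x \<in> f -` A \<inter> space M \<longleftrightarrow> x \<in> g -` A \<inter> space (completion M)"
      by (rule AE_completion) (use eq in eventually_elim, simp)
    show "f -` A \<inter> space M \<in> sets (completion M)"
      using measurable_sets[OF f A] by simp
  qed auto
qed (use g in auto)

lemma emeasure_lborel_rectangle:
  fixes A B :: "real set"
  assumes "A \<in> sets borel" "B \<in> sets borel"
  shows "emeasure lborel (A \<times> B) = emeasure lborel A * emeasure lborel B"
  using lborel.emeasure_pair_measure_Times[of A lborel B] assms by (simp add: lborel_prod)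

lemma unif2_eq_uniform_measure:
  "unif \<Otimes>\<^sub>M unif = uniform_measure lborel ({0..1} \<times> {0..1})"
proof (rule pair_measure_eqI)
  fix A B assume "A \<in> sets unif" "B \<in> sets unif"
  then have [measurable]: "A \<in> sets borel" "B \<in> sets borel" by auto
  have AB: "A \<times> B \<in> sets (borel :: (real \<times> real) measure)"
    by (subst borel_prod[symmetric]) measurable
  have S: "{0..1} \<times> {0..1} \<in> sets (borel :: (real \<times> real) measure)"
    by (subst borel_prod[symmetric]) measurable
  have "({0..1} \<times> {0..1}) \<inter> A \<times> B = ({0..1} \<inter> A) \<times> ({0..1} \<inter> B)" by auto
  then show "emeasure unif A * emeasure unif B
      = emeasure (uniform_measure lborel ({0..1} \<times> {0..1})) (A \<times> B)"
    using AB S by (simp add: emeasure_uniform_measure emeasure_lborel_rectangle divide_ennreal_def)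
next
  have "sets (unif \<Otimes>\<^sub>M unif) = sets (borel \<Otimes>\<^sub>M borel)"
    by (intro sets_pair_measure_cong) auto
  also have "\<dots> = sets (uniform_measure lborel ({0..1} \<times> {0..1}) :: (real \<times> real) measure)"
    by (subst borel_prod) simp
  finally show "sets (unif \<Otimes>\<^sub>M unif) = sets (uniform_measure lborel ({0..1} \<times> {0..1}))" .
qed (auto intro: prob_space_imp_sigma_finite prob_space_unif)

lemma AE_unif2_iff:
  "(AE p in unif \<Otimes>\<^sub>M unif. P p) \<longleftrightarrow> (AE p in lborel. p \<in> {0..1} \<times> {0..1} \<longrightarrow> P p)"
proof -
  have "emeasure lborel ({0..1} \<times> {0..1} :: (real \<times> real) set) = 1"
    by (subst emeasure_lborel_rectangle) auto
  then show ?thesis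
    unfolding unif2_eq_uniform_measure by (intro AE_uniform_measure) auto
qed

lemma AE_unif2_swap:
  assumes "AE p in unif \<Otimes>\<^sub>M unif. P (fst p) (snd p)"
  shows "AE p in unif \<Otimes>\<^sub>M unif. P (snd p) (fst p)"
proof -
  interpret P: pair_prob_space unif unif
    by (simp add: pair_prob_space_def pair_sigma_finite_def prob_space_imp_sigma_finite prob_space_unif)
  have "AE p in distr (unif \<Otimes>\<^sub>M unif) (unif \<Otimes>\<^sub>M unif) (\<lambda>(x, y). (y, x)). P (fst p) (snd p)"
    using assms by (subst P.distr_pair_swap[symmetric])
  from AE_distrD[OF _ this] show ?thesis by (simp add: case_prod_beta)
qed

text \<open>A Borel function equal to \<open>W\<close> almost everywhere on the square need not satisfy the
  tournament identity or the bounds on a null set, nor anything outside the square. Clamping it to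
  \<open>[0,1]\<close> and averaging with the complement of its transpose restores both everywhere and
  changes nothing where the identities already hold. That uses the almost-everywhere equality at
  \<open>(x, y)\<close> and at \<open>(y, x)\<close>.\<close>

lemma tournamenton_AE_kernel:
  assumes W: "tournamenton W"
  obtains V where "tournament_kernel V"
    "AE p in unif \<Otimes>\<^sub>M unif. W (fst p) (snd p) = V (fst p) (snd p)"
proof -
  let ?S = "{0..1} \<times> {0..1} :: (real \<times> real) set"
  have S: "?S \<in> sets lebesgue"
    by (intro sets_completionI_sets) (auto intro: borel_closed closed_Times)
  have "(\<lambda>p. if p \<in> ?S then case_prod W p else 0) \<in> borel_measurable lebesgue"
    using W borel_measurable_if[OF S, of "case_prod W"] by (simp add: tournamenton_def)
  from completion_ex_borel_measurable_real[OF this] obtain g where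
    g: "g \<in> borel_measurable lborel" and "AE p in lborel. (if p \<in> ?S then case_prod W p else 0) = g p"
    by auto
  then have "AE p in lborel. p \<in> ?S \<longrightarrow> (fst p, snd p) \<in> ?S \<and> W (fst p) (snd p) = g (fst p, snd p)"
    by eventually_elim (auto split: if_splits)
  then have eq: "AE p in unif \<Otimes>\<^sub>M unif. (fst p, snd p) \<in> ?S \<and> W (fst p) (snd p) = g (fst p, snd p)"
    by (subst AE_unif2_iff)
  have [measurable]: "g \<in> borel_measurable (borel \<Otimes>\<^sub>M borel)"
    using g by (simp add: borel_prod)
  define c where "c x y = max 0 (min 1 (g (x, y)))" for x y
  define V where "V x y = (c x y + (1 - c y x)) / 2" for x y
  have [measurable]: "case_prod c \<in> borel_measurable (borel \<Otimes>\<^sub>M borel)"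
    unfolding c_def by measurable
  have "tournament_kernel V"
  proof
    show "case_prod V \<in> borel_measurable (borel \<Otimes>\<^sub>M borel)"
      unfolding V_def by measurable
    show "0 \<le> V x y" "V x y + V y x = 1" for x y
      by (auto simp: V_def c_def max_def min_def field_simps)
  qed
  moreover have "AE p in unif \<Otimes>\<^sub>M unif. W (fst p) (snd p) = V (fst p) (snd p)"
    using eq AE_unif2_swap[of "\<lambda>x y. (x, y) \<in> ?S \<and> W x y = g (x, y)", OF eq]
  proof eventually_elim
    case (elim p)
    obtain x y where p: "p = (x, y)" by (cases p)
    have "x \<in> {0..1}" "y \<in> {0..1}" and xy: "W x y = g (x, y)" "W y x = g (y, x)"
      using elim by (auto simp: p)
    then have "0 \<le> W x y" "0 \<le> W y x" "W x y + W y x = 1"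
      using W unfolding tournamenton_def by blast+
    then show ?case
      by (simp add: p V_def c_def xy)
  qed
  ultimately show ?thesis by (rule that)
qed

section \<open>The tournament given the latent variables\<close>

text \<open>The independent random bits are indexed by increasing pairs, so an event that prescribes the
  orientation of some edges must be brought into this form before their independence applies.
  The factor \<open>1\<close> stands for the bits that are left free.\<close>

lemma prod_orient_pairs:
  fixes g :: "nat \<times> nat \<Rightarrow> real"
  assumes D: "D \<subseteq> {1..n} \<times> {1..n}" "irrefl D" "D \<inter> D\<inverse> = {}"
  shows "(\<Prod>e\<in>D. g e) = (\<Prod>(u, v)\<in>{(u, v). 1 \<le> u \<and> u < v \<and> v \<le> n}.
           if (u, v) \<in> D then g (u, v) else if (v, u) \<in> D then g (v, u) else 1)"
    (is "_ = prod ?G ?E")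
proof -
  let ?s = "\<lambda>(u, v). (min u v, max u v) :: nat \<times> nat"
  have fin: "finite ?E" by (rule finite_subset[of _ "{1..n} \<times> {1..n}"]) auto
  have ne: "u \<noteq> v" if "(u, v) \<in> D" for u v
    using D(2) that by (auto simp: irrefl_def)
  have asym: "(v, u) \<notin> D" if "(u, v) \<in> D" for u v
    using D(3) that by blast
  have inj: "inj_on ?s D"
  proof (rule inj_onI)
    fix e e' assume e: "e \<in> D" "e' \<in> D" and eq: "?s e = ?s e'"
    obtain u v u' v' where uv: "e = (u, v)" "e' = (u', v')" by (cases e, cases e')
    have "e' = (u, v) \<or> e' = (v, u)"
      using eq uv by (auto simp: min_def max_def split: if_splits)
    then show "e = e'" using e asym[of u v] uv by auto
  qed
  have "(\<Prod>e\<in>D. g e) = prod (?G \<circ> ?s) D"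
  proof (intro prod.cong refl)
    fix e assume "e \<in> D"
    then show "g e = (?G \<circ> ?s) e"
      using asym[of "fst e" "snd e"] ne[of "fst e" "snd e"] by (cases e) (auto simp: min_def max_def)
  qed
  also have "\<dots> = prod ?G (?s ` D)"
    by (rule prod.reindex[OF inj, symmetric])
  also have "\<dots> = prod ?G ?E"
  proof (rule prod.mono_neutral_left[OF fin])
    show "?s ` D \<subseteq> ?E"
    proof safe
      fix u v assume uv: "(u, v) \<in> D"
      then show "1 \<le> min u v" "min u v < max u v" "max u v \<le> n"
        using D(1) ne[OF uv] by auto
    qed
    show "\<forall>e\<in>?E - ?s ` D. ?G e = 1"
    proof safe
      fix u v :: nat assume uv: "u < v" and no: "(u, v) \<notin> ?s ` D"
      have "(u, v) \<notin> D" "(v, u) \<notin> D"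
        using no uv by (force simp: image_iff min_def max_def)+
      then show "(if (u, v) \<in> D then g (u, v) else if (v, u) \<in> D then g (v, u) else 1) = 1"
        by simp
    qed
  qed
  finally show ?thesis .
qed

lemma conditional_tournament_cong:
  assumes "\<forall>u\<in>{1..n}. \<forall>v\<in>{1..n}. u \<noteq> v \<longrightarrow> W (\<eta> u) (\<eta> v) = W' (\<eta> u) (\<eta> v)"
  shows "conditional_tournament n W \<eta> = conditional_tournament n W' \<eta>"
  unfolding conditional_tournament_def
  using assms by (intro map_pmf_cong refl Pi_pmf_cong) auto

context tournament_kernel
begin

text \<open>Distinct edges are conditionally independent, so edges prescribed without contradiction or
  repetition occur with the product of their probabilities.\<close>

lemma expectation_conditional_tournament:
  assumes D: "D \<subseteq> {1..n} \<times> {1..n}" "irrefl D" "D \<inter> D\<inverse> = {}"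
  shows "measure_pmf.expectation (conditional_tournament n V \<eta>) (\<lambda>a. \<Prod>(u, v)\<in>D. of_bool (a u v))
    = (\<Prod>(u, v)\<in>D. V (\<eta> u) (\<eta> v))"
proof -
  let ?E = "{(u, v). 1 \<le> u \<and> u < v \<and> v \<le> n}"
  let ?h = "\<lambda>(u, v) x. if (u, v) \<in> D then of_bool x else if (v, u) \<in> D then of_bool (\<not> x) else 1 :: real"
  have fin: "finite ?E" by (rule finite_subset[of _ "{1..n} \<times> {1..n}"]) auto
  have "(\<Prod>(u, v)\<in>D. of_bool (orient n b u v)) = (\<Prod>e\<in>?E. ?h e (b e))" for b :: "nat \<times> nat \<Rightarrow> bool"
    by (subst prod_orient_pairs[OF D]) (auto simp: orient_def intro!: prod.cong)
  then have "measure_pmf.expectation (conditional_tournament n V \<eta>) (\<lambda>a. \<Prod>(u, v)\<in>D. of_bool (a u v))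
    = measure_pmf.expectation (Pi_pmf ?E False (\<lambda>(u, v). bernoulli_pmf (V (\<eta> u) (\<eta> v))))
        (\<lambda>b. \<Prod>e\<in>?E. ?h e (b e))"
    unfolding conditional_tournament_def by simp
  also have "\<dots> = (\<Prod>e\<in>?E. measure_pmf.expectation (case e of (u, v) \<Rightarrow> bernoulli_pmf (V (\<eta> u) (\<eta> v))) (?h e))"
    by (rule expectation_prod_Pi_pmf[OF fin]) (auto intro: integrable_measure_pmf_finite)
  also have "\<dots> = (\<Prod>(u, v)\<in>?E. if (u, v) \<in> D then V (\<eta> u) (\<eta> v)
      else if (v, u) \<in> D then V (\<eta> v) (\<eta> u) else 1)"
  proof (intro prod.cong refl)
    fix e assume "e \<in> ?E"
    obtain u v where e: "e = (u, v)" by (cases e)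
    show "measure_pmf.expectation (case e of (u, v) \<Rightarrow> bernoulli_pmf (V (\<eta> u) (\<eta> v))) (?h e) =
      (case e of (u, v) \<Rightarrow> if (u, v) \<in> D then V (\<eta> u) (\<eta> v)
      else if (v, u) \<in> D then V (\<eta> v) (\<eta> u) else 1)"
      using kernel_add_swap[of "\<eta> u" "\<eta> v"]
      by (simp add: e kernel_nonneg kernel_le_one)
  qed
  also have "\<dots> = (\<Prod>(u, v)\<in>D. V (\<eta> u) (\<eta> v))"
    by (subst prod_orient_pairs[OF D]) auto
  finally show ?thesis .
qed

text \<open>Only finitely many bit patterns carry mass, and the mass of each is a polynomial in the values of
  the kernel.\<close>

lemma conditional_tournament_measurable [measurable]:
  "(\<lambda>\<eta>. measure_pmf (conditional_tournament n V \<eta>))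
     \<in> unif_prod {1..n} \<rightarrow>\<^sub>M subprob_algebra (count_space UNIV)"
proof (rule measurable_subprob_algebra)
  fix A :: "(nat \<Rightarrow> nat \<Rightarrow> bool) set"
  let ?E = "{(u, v). 1 \<le> u \<and> u < v \<and> v \<le> n}"
  let ?B = "orient n -` A \<inter> PiE_dflt ?E False (\<lambda>_. UNIV)"
  let ?p = "\<lambda>\<eta>. Pi_pmf ?E False (\<lambda>(u, v). bernoulli_pmf (V (\<eta> u) (\<eta> v)))"
  have fin: "finite ?E" by (rule finite_subset[of _ "{1..n} \<times> {1..n}"]) auto
  have B: "finite ?B" using fin by (intro finite_Int disjI2 finite_PiE_dflt) auto
  have "emeasure (measure_pmf (conditional_tournament n V \<eta>)) A =
      ennreal (\<Sum>b\<in>?B. \<Prod>(u, v)\<in>?E. if b (u, v) then V (\<eta> u) (\<eta> v) else 1 - V (\<eta> u) (\<eta> v))" for \<eta>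
  proof -
    have "emeasure (measure_pmf (conditional_tournament n V \<eta>)) A = emeasure (?p \<eta>) (orient n -` A)"
      by (simp add: conditional_tournament_def)
    also have "\<dots> = emeasure (?p \<eta>) ?B"
      using set_Pi_pmf_subset[OF fin, of False "\<lambda>(u, v). bernoulli_pmf (V (\<eta> u) (\<eta> v))"]
      by (intro emeasure_eq_AE AE_pmfI) (auto simp: PiE_dflt_def)
    also have "\<dots> = ennreal (\<Sum>b\<in>?B. pmf (?p \<eta>) b)"
      using B by (simp add: measure_pmf.emeasure_eq_measure measure_measure_pmf_finite)
    also have "(\<Sum>b\<in>?B. pmf (?p \<eta>) b) =
        (\<Sum>b\<in>?B. \<Prod>(u, v)\<in>?E. if b (u, v) then V (\<eta> u) (\<eta> v) else 1 - V (\<eta> u) (\<eta> v))"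
    proof (intro sum.cong refl)
      fix b assume "b \<in> ?B"
      then have "\<forall>e. e \<notin> ?E \<longrightarrow> b e = False"
        by (auto simp: PiE_dflt_def)
      then have "pmf (?p \<eta>) b = (\<Prod>e\<in>?E. pmf (case e of (u, v) \<Rightarrow> bernoulli_pmf (V (\<eta> u) (\<eta> v))) (b e))"
        by (subst pmf_Pi[OF fin]) (rule if_P)
      also have "\<dots> = (\<Prod>(u, v)\<in>?E. if b (u, v) then V (\<eta> u) (\<eta> v) else 1 - V (\<eta> u) (\<eta> v))"
        by (intro prod.cong) (auto simp: kernel_nonneg kernel_le_one)
      finally show "pmf (?p \<eta>) b = \<dots>" .
    qed
    finally show ?thesis .
  qed
  moreover have "(\<lambda>\<eta>. ennreal (\<Sum>b\<in>?B. \<Prod>(u, v)\<in>?E. if b (u, v) then V (\<eta> u) (\<eta> v) else 1 - V (\<eta> u) (\<eta> v)))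
      \<in> borel_measurable (unif_prod {1..n})"
  proof (intro measurable_compose[OF _ measurable_ennreal] borel_measurable_sum borel_measurable_prod)
    fix b e assume "e \<in> ?E"
    then obtain u v where e: "e = (u, v)" and uv [measurable]: "u \<in> {1..n}" "v \<in> {1..n}"
      by auto
    show "(\<lambda>\<eta>. case e of (u, v) \<Rightarrow> if b (u, v) then V (\<eta> u) (\<eta> v) else 1 - V (\<eta> u) (\<eta> v))
        \<in> borel_measurable (unif_prod {1..n})"
      using kernel_coordinates_measurable[OF uv]
      by (cases "b (u, v)") (auto simp: e intro!: borel_measurable_diff)
  qed
  ultimately show "(\<lambda>\<eta>. emeasure (measure_pmf (conditional_tournament n V \<eta>)) A) \<in> borel_measurable (unif_prod {1..n})"
    by (simp only:)
qed (auto intro: measure_pmf.subprob_space_axioms)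

end

section \<open>Deviation of a mean with few correlated pairs\<close>

text \<open>All covariances are at most \<open>1\<close> and those outside \<open>B\<close> vanish, so the
  variance of the mean is at most the proportion of \<open>B\<close> among all pairs.\<close>

lemma (in prob_space) mean_deviation_bound:
  fixes Z :: "'i \<Rightarrow> 'a \<Rightarrow> real" and a t :: real
  assumes I: "finite I" "I \<noteq> {}" and B: "B \<subseteq> I \<times> I"
    and [measurable]: "\<And>i. Z i \<in> borel_measurable M"
    and Z: "\<And>i \<omega>. 0 \<le> Z i \<omega>" "\<And>i \<omega>. Z i \<omega> \<le> 1"
    and mean: "\<And>i. i \<in> I \<Longrightarrow> expectation (Z i) = t"
    and uncorrelated: "\<And>i j. (i, j) \<in> I \<times> I - B \<Longrightarrow> expectation (\<lambda>\<omega>. Z i \<omega> * Z j \<omega>) = t\<^sup>2"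
    and a: "0 < a"
  shows "prob {\<omega> \<in> space M. \<bar>(\<Sum>i\<in>I. Z i \<omega>) / card I - t\<bar> \<ge> a} \<le> card B / ((card I)\<^sup>2 * a\<^sup>2)"
proof -
  let ?N = "real (card I)"
  let ?X = "\<lambda>\<omega>. (\<Sum>i\<in>I. Z i \<omega>) / ?N - t"
  have N: "?N > 0" using I by (simp add: card_gt_0_iff)
  have int: "integrable M (Z i)" "integrable M (\<lambda>\<omega>. Z i \<omega> * Z j \<omega>)" for i j
    using Z by (auto intro!: integrable_const_bound[where B = 1] AE_I2 mult_le_one simp: abs_mult abs_of_nonneg)
  have int2: "integrable M (\<lambda>\<omega>. (Z i \<omega> - t) * (Z j \<omega> - t))" for i j
    by (simp add: algebra_simps int)
  have cov: "expectation (\<lambda>\<omega>. (Z i \<omega> - t) * (Z j \<omega> - t)) = expectation (\<lambda>\<omega>. Z i \<omega> * Z j \<omega>) - t\<^sup>2"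
    if "i \<in> I" "j \<in> I" for i j
    using that by (simp add: algebra_simps int mean prob_space power2_eq_square)
  have sq: "(?X \<omega>)\<^sup>2 = (\<Sum>i\<in>I. \<Sum>j\<in>I. (Z i \<omega> - t) * (Z j \<omega> - t)) / ?N\<^sup>2" for \<omega>
  proof -
    have "?X \<omega> = (\<Sum>i\<in>I. Z i \<omega> - t) / ?N"
      using N by (simp add: sum_subtractf field_simps)
    then show ?thesis by (simp add: power_divide power2_eq_square sum_product)
  qed
  have "expectation (\<lambda>\<omega>. (?X \<omega>)\<^sup>2)
      = (\<Sum>i\<in>I. \<Sum>j\<in>I. expectation (\<lambda>\<omega>. (Z i \<omega> - t) * (Z j \<omega> - t))) / ?N\<^sup>2"
    unfolding sq by (simp add: int2)
  also have "\<dots> = (\<Sum>(i, j)\<in>I \<times> I. expectation (\<lambda>\<omega>. (Z i \<omega> - t) * (Z j \<omega> - t))) / ?N\<^sup>2"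
    by (simp add: sum.cartesian_product)
  also have "\<dots> \<le> (\<Sum>p\<in>I \<times> I. of_bool (p \<in> B)) / ?N\<^sup>2"
  proof (intro divide_right_mono sum_mono)
    fix p assume p: "p \<in> I \<times> I"
    obtain i j where ij: "p = (i, j)" by (cases p)
    have "expectation (\<lambda>\<omega>. Z i \<omega> * Z j \<omega>) \<le> expectation (\<lambda>\<omega>. 1)"
      using Z by (intro integral_mono int) (auto intro: mult_le_one)
    then have "expectation (\<lambda>\<omega>. Z i \<omega> * Z j \<omega>) \<le> 1"
      by (simp add: prob_space)
    then have "expectation (\<lambda>\<omega>. Z i \<omega> * Z j \<omega>) - t\<^sup>2 \<le> 1"
      using zero_le_power2[of t] by linarith
    then have "expectation (\<lambda>\<omega>. Z i \<omega> * Z j \<omega>) - t\<^sup>2 \<le> of_bool (p \<in> B)"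
      using uncorrelated[of i j] p by (cases "p \<in> B") (auto simp: ij)
    then show "(case p of (i, j) \<Rightarrow> expectation (\<lambda>\<omega>. (Z i \<omega> - t) * (Z j \<omega> - t))) \<le> of_bool (p \<in> B)"
      using p by (simp add: ij cov)
  qed simp
  also have "(\<Sum>p\<in>I \<times> I. of_bool (p \<in> B)) = real (card B)"
    using I B by (simp add: of_bool_def sum.If_cases Int_absorb1)
  finally have var: "expectation (\<lambda>\<omega>. (?X \<omega>)\<^sup>2) \<le> card B / ?N\<^sup>2" .
  have "prob {\<omega> \<in> space M. \<bar>?X \<omega>\<bar> \<ge> a} \<le> expectation (\<lambda>\<omega>. (?X \<omega>)\<^sup>2) / a\<^sup>2"
    by (rule second_moment_method) (auto simp: a sq int2)
  also have "\<dots> \<le> (card B / ?N\<^sup>2) / a\<^sup>2"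
    using var by (intro divide_right_mono) auto
  finally show ?thesis by simp
qed

section \<open>Counting pairs of quadruples with common vertices\<close>

definition vertices :: "nat \<times> nat \<times> nat \<times> nat \<Rightarrow> nat set" where
  "vertices = (\<lambda>(a, b, c, d). {a, b, c, d})"

definition quadruples :: "nat \<Rightarrow> (nat \<times> nat \<times> nat \<times> nat) set" where
  "quadruples n = {(a, b, c, d). {a, b, c, d} \<subseteq> {1..n} \<and> distinct [a, b, c, d]}"

lemma finite_quadruples: "finite (quadruples n)"
  by (rule finite_subset[of _ "{1..n} \<times> {1..n} \<times> {1..n} \<times> {1..n}"]) (auto simp: quadruples_def)

lemma card_quadruples:
  assumes "4 \<le> n"
  shows "real (card (quadruples n)) = real n * (real n - 1) * (real n - 2) * (real n - 3)"
proof -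
  let ?L = "{xs. length xs = 4 \<and> distinct xs \<and> set xs \<subseteq> {1..n}}"
  have "bij_betw (\<lambda>(a, b, c, d). [a, b, c, d]) (quadruples n) ?L"
  proof (rule bij_betw_imageI)
    show "(\<lambda>(a, b, c, d). [a, b, c, d]) ` quadruples n = ?L"
    proof (intro equalityI subsetI)
      fix xs assume xs: "xs \<in> ?L"
      then obtain a b c d where "xs = [a, b, c, d]"
        by (auto simp: eval_nat_numeral length_Suc_conv)
      with xs show "xs \<in> (\<lambda>(a, b, c, d). [a, b, c, d]) ` quadruples n"
        by (intro image_eqI[of _ _ "(a, b, c, d)"]) (auto simp: quadruples_def)
    qed (auto simp: quadruples_def)
  qed (auto simp: inj_on_def)
  then have "card (quadruples n) = card ?L" by (rule bij_betw_same_card)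
  also have "\<dots> = \<Prod>{n - 4 + 1..n}"
    using assms by (subst card_lists_distinct_length_eq) auto
  also have "{n - 4 + 1..n} = {n - 3, n - 2, n - 1, n}"
    using assms by auto
  finally have card: "card (quadruples n) = \<Prod>{n - 3, n - 2, n - 1, n}" .
  obtain m where "n = m + 4"
    using assms by (metis add.commute le_Suc_ex)
  then show ?thesis
    unfolding card by (simp add: algebra_simps)
qed

lemma card_quadruples_lower:
  assumes "6 \<le> n"
  shows "real n ^ 4 / 16 \<le> real (card (quadruples n))"
proof -
  have "(real n / 2) ^ 4 = real n / 2 * (real n / 2) * (real n / 2) * (real n / 2)"
    by (simp add: power4_eq_xxxx)
  also have "\<dots> \<le> real n * (real n - 1) * (real n - 2) * (real n - 3)"
    using assms by (intro mult_mono) auto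
  finally show ?thesis using assms by (simp add: card_quadruples power_divide)
qed

lemma card_quadruples_upper: "card (quadruples n) \<le> n ^ 4"
proof -
  have "card (quadruples n) \<le> card ({1..n} \<times> {1..n} \<times> {1..n} \<times> {1..n})"
    by (rule card_mono) (auto simp: quadruples_def)
  then show ?thesis by (simp add: power4_eq_xxxx)
qed

lemma card_quadruples_through:
  "card {s \<in> quadruples n. v \<in> vertices s} \<le> 4 * n ^ 3"
proof -
  let ?F = "[\<lambda>x y z. (v, x, y, z), \<lambda>x y z. (x, v, y, z), \<lambda>x y z. (x, y, v, z), \<lambda>x y z. (x, y, z, v)]"
  let ?D = "set ?F \<times> {1..n} \<times> {1..n} \<times> {1..n}"
  have "{s \<in> quadruples n. v \<in> vertices s} \<subseteq> (\<lambda>(f, x, y, z). f x y z) ` ?D"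
  proof
    fix s assume s: "s \<in> {s \<in> quadruples n. v \<in> vertices s}"
    obtain a b c d where abcd: "s = (a, b, c, d)" by (cases s)
    have "a \<in> {1..n}" "b \<in> {1..n}" "c \<in> {1..n}" "d \<in> {1..n}" "v = a \<or> v = b \<or> v = c \<or> v = d"
      using s by (auto simp: quadruples_def vertices_def abcd)
    then have "\<exists>f\<in>set ?F. \<exists>x\<in>{1..n}. \<exists>y\<in>{1..n}. \<exists>z\<in>{1..n}. s = f x y z"
      by (simp add: abcd del: atLeastAtMost_iff) blast
    then obtain f x y z where "f \<in> set ?F" "x \<in> {1..n}" "y \<in> {1..n}" "z \<in> {1..n}" "s = f x y z"
      by blast
    then show "s \<in> (\<lambda>(f, x, y, z). f x y z) ` ?D"
      by (intro image_eqI[of _ _ "(f, x, y, z)"]) auto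
  qed
  then have "card {s \<in> quadruples n. v \<in> vertices s} \<le> card ?D"
    by (rule surj_card_le[rotated]) simp
  also have "\<dots> = card (set ?F) * n ^ 3"
    by (simp only: card_cartesian_product card_atLeastAtMost power3_eq_cube) simp
  also have "\<dots> \<le> 4 * n ^ 3"
    by (intro mult_right_mono order.trans[OF card_length]) auto
  finally show ?thesis .
qed

lemma card_quadruples_through_two:
  assumes "u \<noteq> v"
  shows "card {s \<in> quadruples n. u \<in> vertices s \<and> v \<in> vertices s} \<le> 12 * n ^ 2"
proof -
  let ?F = "[\<lambda>x y. (u, v, x, y), \<lambda>x y. (u, x, v, y), \<lambda>x y. (u, x, y, v),
      \<lambda>x y. (x, u, v, y), \<lambda>x y. (x, u, y, v), \<lambda>x y. (x, y, u, v),
      \<lambda>x y. (v, u, x, y), \<lambda>x y. (v, x, u, y), \<lambda>x y. (v, x, y, u),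
      \<lambda>x y. (x, v, u, y), \<lambda>x y. (x, v, y, u), \<lambda>x y. (x, y, v, u)]"
  let ?D = "set ?F \<times> {1..n} \<times> {1..n}"
  have "{s \<in> quadruples n. u \<in> vertices s \<and> v \<in> vertices s} \<subseteq> (\<lambda>(f, x, y). f x y) ` ?D"
  proof
    fix s assume s: "s \<in> {s \<in> quadruples n. u \<in> vertices s \<and> v \<in> vertices s}"
    obtain a b c d where abcd: "s = (a, b, c, d)" by (cases s)
    have "a \<in> {1..n}" "b \<in> {1..n}" "c \<in> {1..n}" "d \<in> {1..n}"
      "u = a \<or> u = b \<or> u = c \<or> u = d" "v = a \<or> v = b \<or> v = c \<or> v = d"
      using s by (auto simp: quadruples_def vertices_def abcd)
    then have "\<exists>f\<in>set ?F. \<exists>x\<in>{1..n}. \<exists>y\<in>{1..n}. s = f x y"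
      using assms by (elim disjE) (simp_all add: abcd del: atLeastAtMost_iff)
    then obtain f x y where "f \<in> set ?F" "x \<in> {1..n}" "y \<in> {1..n}" "s = f x y"
      by blast
    then show "s \<in> (\<lambda>(f, x, y). f x y) ` ?D"
      by (intro image_eqI[of _ _ "(f, x, y)"]) auto
  qed
  then have "card {s \<in> quadruples n. u \<in> vertices s \<and> v \<in> vertices s} \<le> card ?D"
    by (rule surj_card_le[rotated]) simp
  also have "\<dots> = card (set ?F) * n ^ 2"
    by (simp only: card_cartesian_product card_atLeastAtMost power2_eq_square) simp
  also have "\<dots> \<le> 12 * n ^ 2"
    by (intro mult_right_mono order.trans[OF card_length]) auto
  finally show ?thesis .
qed

lemma finite_vertices: "finite (vertices s)"
  by (cases s) (simp add: vertices_def)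

lemma card_vertices_le: "card (vertices s) \<le> 4"
  by (cases s) (auto simp: vertices_def intro!: order.trans[OF card_insert_le_m1])

lemma card_touching_pairs:
  "card {(s, s') \<in> quadruples n \<times> quadruples n. vertices s \<inter> vertices s' \<noteq> {}} \<le> 16 * n ^ 7"
proof -
  let ?Q = "quadruples n"
  note V = finite_vertices card_vertices_le
  have "{(s, s') \<in> ?Q \<times> ?Q. vertices s \<inter> vertices s' \<noteq> {}}
      = (SIGMA s:?Q. \<Union>v\<in>vertices s. {s' \<in> ?Q. v \<in> vertices s'})" by auto
  also have "card \<dots> = (\<Sum>s\<in>?Q. card (\<Union>v\<in>vertices s. {s' \<in> ?Q. v \<in> vertices s'}))"
    using V by (intro card_SigmaI) (auto simp: finite_quadruples)
  also have "\<dots> \<le> (\<Sum>s\<in>?Q. \<Sum>v\<in>vertices s. card {s' \<in> ?Q. v \<in> vertices s'})"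
    using V by (intro sum_mono card_UN_le)
  also have "\<dots> \<le> (\<Sum>s\<in>?Q. \<Sum>v\<in>vertices s. 4 * n ^ 3)"
    by (intro sum_mono card_quadruples_through)
  also have "\<dots> \<le> (\<Sum>s\<in>?Q. 4 * (4 * n ^ 3))"
    using V by (intro sum_mono) (simp del: mult.assoc)
  also have "\<dots> \<le> n ^ 4 * (4 * (4 * n ^ 3))"
    using card_quadruples_upper[of n] by (simp only: sum_constant of_nat_id mult_right_mono)
  also have "\<dots> = 16 * n ^ 7" by algebra
  finally show ?thesis .
qed

lemma card_edge_sharing_pairs:
  "card {(s, s') \<in> quadruples n \<times> quadruples n.
      \<exists>u v. u \<noteq> v \<and> {u, v} \<subseteq> vertices s \<inter> vertices s'} \<le> 192 * n ^ 6"
proof -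
  let ?Q = "quadruples n"
  let ?R = "\<lambda>p. {s' \<in> ?Q. fst p \<in> vertices s' \<and> snd p \<in> vertices s'}"
  let ?P = "\<lambda>s. {p \<in> vertices s \<times> vertices s. fst p \<noteq> snd p}"
  note V = finite_vertices card_vertices_le
  have P: "finite (?P s)" "card (?P s) \<le> 16" for s
  proof -
    have "card (?P s) \<le> card (vertices s \<times> vertices s)"
      using V by (intro card_mono) auto
    also have "\<dots> \<le> 4 * 4" unfolding card_cartesian_product by (intro mult_mono V(2)) auto
    finally show "card (?P s) \<le> 16" by simp
  qed (use V in auto)
  have "{(s, s') \<in> ?Q \<times> ?Q. \<exists>u v. u \<noteq> v \<and> {u, v} \<subseteq> vertices s \<inter> vertices s'}
      = (SIGMA s:?Q. \<Union>p\<in>?P s. ?R p)" by auto blast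
  also have "card \<dots> = (\<Sum>s\<in>?Q. card (\<Union>p\<in>?P s. ?R p))"
    using P by (intro card_SigmaI) (auto simp: finite_quadruples)
  also have "\<dots> \<le> (\<Sum>s\<in>?Q. \<Sum>p\<in>?P s. card (?R p))"
    using P by (intro sum_mono card_UN_le)
  also have "\<dots> \<le> (\<Sum>s\<in>?Q. \<Sum>p\<in>?P s. 12 * n ^ 2)"
    by (intro sum_mono card_quadruples_through_two) auto
  also have "\<dots> \<le> (\<Sum>s\<in>?Q. 16 * (12 * n ^ 2))"
    using P by (intro sum_mono) (simp del: mult.assoc)
  also have "\<dots> \<le> n ^ 4 * (16 * (12 * n ^ 2))"
    using card_quadruples_upper[of n] by (simp only: sum_constant of_nat_id mult_right_mono)
  also have "\<dots> = 192 * n ^ 6" by algebra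
  finally show ?thesis .
qed

section \<open>Means and covariances of the transitivity indicators\<close>

definition tr4_at :: "('v \<Rightarrow> 'v \<Rightarrow> real) \<Rightarrow> 'v \<times> 'v \<times> 'v \<times> 'v \<Rightarrow> real" where
  "tr4_at w = (\<lambda>(a, b, c, d). tr4 w a b c d)"

definition tr4_pairs :: "'v \<times> 'v \<times> 'v \<times> 'v \<Rightarrow> ('v \<times> 'v) set" where
  "tr4_pairs = (\<lambda>(a, b, c, d). {(a, b), (a, c), (a, d), (b, c), (b, d), (c, d)})"

lemma tr4_at_eq_prod:
  assumes "s \<in> quadruples n"
  shows "tr4_at w s = (\<Prod>(u, v)\<in>tr4_pairs s. w u v)"
proof -
  obtain a b c d where s: "s = (a, b, c, d)" by (cases s)
  have "a \<noteq> b" "a \<noteq> c" "a \<noteq> d" "b \<noteq> c" "b \<noteq> d" "c \<noteq> d"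
    using assms by (auto simp: s quadruples_def)
  then show ?thesis by (simp add: s tr4_at_def tr4_def tr4_pairs_def mult.assoc)
qed

lemma tr4_pairs_props:
  assumes "s \<in> quadruples n"
  shows "finite (tr4_pairs s)" "tr4_pairs s \<subseteq> vertices s \<times> vertices s" "vertices s \<subseteq> {1..n}"
    "irrefl (tr4_pairs s)" "tr4_pairs s \<inter> (tr4_pairs s)\<inverse> = {}"
proof -
  obtain a b c d where s: "s = (a, b, c, d)" by (cases s)
  have "a \<noteq> b" "a \<noteq> c" "a \<noteq> d" "b \<noteq> c" "b \<noteq> d" "c \<noteq> d" "{a, b, c, d} \<subseteq> {1..n}"
    using assms by (auto simp: s quadruples_def)
  then show "finite (tr4_pairs s)" "tr4_pairs s \<subseteq> vertices s \<times> vertices s" "vertices s \<subseteq> {1..n}"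
    "irrefl (tr4_pairs s)" "tr4_pairs s \<inter> (tr4_pairs s)\<inverse> = {}"
    by (auto simp: s tr4_pairs_def vertices_def irrefl_def)
qed

lemma tr4_at_bounds:
  assumes "\<And>u v. 0 \<le> w u v" "\<And>u v. w u v \<le> 1"
  shows "0 \<le> tr4_at w s" "tr4_at w s \<le> 1"
  using assms unfolding tr4_at_def tr4_def
  by (auto split: prod.splits intro!: mult_nonneg_nonneg mult_le_one)

abbreviation tr4_indicator :: "('v \<Rightarrow> 'v \<Rightarrow> bool) \<Rightarrow> 'v \<times> 'v \<times> 'v \<times> 'v \<Rightarrow> real" where
  "tr4_indicator a \<equiv> tr4_at (\<lambda>u v. of_bool (a u v))"

lemma tr4_indicator_bounds: "0 \<le> tr4_indicator a s" "tr4_indicator a s \<le> 1"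
  by (rule tr4_at_bounds; simp)+

lemma t_hat_Tr4_eq_mean:
  assumes "4 \<le> n"
  shows "t_hat_Tr4 n a = (\<Sum>s\<in>quadruples n. tr4_indicator a s) / card (quadruples n)"
proof -
  have "t_hat_Tr4 n a = 1 / (real n * (real n - 1) * (real n - 2) * (real n - 3)) *
      (\<Sum>s\<in>quadruples n. tr4_indicator a s)"
    by (simp only: t_hat_Tr4_def quadruples_def tr4_at_def tr4_def)
  then show ?thesis by (simp add: card_quadruples[OF assms])
qed

context tournament_kernel
begin

lemma conditional_expectation_tr4:
  assumes s: "s \<in> quadruples n"
  shows "measure_pmf.expectation (conditional_tournament n V \<eta>) (\<lambda>a. tr4_indicator a s)
    = tr4_at (\<lambda>u v. V (\<eta> u) (\<eta> v)) s"
  unfolding tr4_at_eq_prod[OF s]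
  using tr4_pairs_props[OF s] by (intro expectation_conditional_tournament) auto

text \<open>With at most one common vertex, the two quadruples have no edge in common, in either orientation,
  and all twelve edges are conditionally independent.\<close>

lemma conditional_expectation_tr4_pair:
  assumes s: "s \<in> quadruples n" and s': "s' \<in> quadruples n"
    and no_edge: "\<not> (\<exists>u v. u \<noteq> v \<and> {u, v} \<subseteq> vertices s \<inter> vertices s')"
  shows "measure_pmf.expectation (conditional_tournament n V \<eta>) (\<lambda>a. tr4_indicator a s * tr4_indicator a s')
    = tr4_at (\<lambda>u v. V (\<eta> u) (\<eta> v)) s * tr4_at (\<lambda>u v. V (\<eta> u) (\<eta> v)) s'"
proof -
  note p = tr4_pairs_props[OF s] and p' = tr4_pairs_props[OF s']
  let ?D = "tr4_pairs s \<union> tr4_pairs s'"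
  have sep: "(u, v) \<notin> tr4_pairs s' \<and> (v, u) \<notin> tr4_pairs s'" if "(u, v) \<in> tr4_pairs s" for u v
  proof -
    have "u \<noteq> v" "u \<in> vertices s" "v \<in> vertices s"
      using that p(2,4) by (auto simp: irrefl_def)
    then have "\<not> (u \<in> vertices s' \<and> v \<in> vertices s')" using no_edge by auto
    then show ?thesis using p'(2) by auto
  qed
  then have disj: "tr4_pairs s \<inter> tr4_pairs s' = {}" "tr4_pairs s \<inter> (tr4_pairs s')\<inverse> = {}"
    by auto
  have prod: "tr4_at w s * tr4_at w s' = (\<Prod>(u, v)\<in>?D. w u v)" for w
    unfolding tr4_at_eq_prod[OF s] tr4_at_eq_prod[OF s']
    by (rule prod.union_disjoint[symmetric]) (use p p' disj in auto)
  show ?thesis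
    unfolding prod
  proof (rule expectation_conditional_tournament)
    show "?D \<subseteq> {1..n} \<times> {1..n}" using p(2,3) p'(2,3) by blast
    show "irrefl ?D" using p(4) p'(4) by (auto simp: irrefl_def)
    show "?D \<inter> ?D\<inverse> = {}" using p(5) p'(5) sep by auto
  qed
qed

text \<open>A Borel kernel depends measurably on the latent variables, so its random tournament can be
  obtained by mixing over the product measure itself instead of its completion.\<close>

definition law :: "nat \<Rightarrow> (nat \<Rightarrow> nat \<Rightarrow> bool) measure" where
  "law n = unif_prod {1..n} \<bind> (\<lambda>\<eta>. measure_pmf (conditional_tournament n V \<eta>))"

lemma prob_space_law: "prob_space (law n)"
  unfolding law_def
  by (rule unif_prod.prob_space_bind[OF _ conditional_tournament_measurable])
     (simp add: measure_pmf.prob_space_axioms)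

lemma sets_law: "sets (law n) = UNIV"
  unfolding law_def
  by (subst sets_bind[where N = "count_space UNIV"]) (auto simp: unif_prod.not_empty)

lemma space_law: "space (law n) = UNIV"
  using sets_eq_imp_space_eq[of "law n" "count_space UNIV"] by (simp add: sets_law)

lemma measurable_law: "f \<in> law n \<rightarrow>\<^sub>M N \<longleftrightarrow> range f \<subseteq> space N"
  by (auto simp: measurable_def sets_law space_law)

lemma expectation_law:
  assumes "\<And>a. \<bar>g a\<bar> \<le> (1 :: real)"
  shows "integral\<^sup>L (law n) g
    = (\<integral>\<eta>. measure_pmf.expectation (conditional_tournament n V \<eta>) g \<partial>unif_prod {1..n})"
  unfolding law_def
  by (rule integral_bind[where B = 1 and B' = 1, OF _ _ conditional_tournament_measurable
        unif_prod.finite_measure_axioms])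
     (auto simp: assms)

text \<open>The two conditional laws agree for almost every value of the latent variables. Completeness of the
  latent space makes the one of \<open>W\<close> measurable as well, and then both mixtures are equal.\<close>

lemma tournament_law_eq_law:
  assumes eq: "AE p in unif \<Otimes>\<^sub>M unif. W (fst p) (snd p) = V (fst p) (snd p)"
  shows "tournament_law n W = law n"
proof -
  let ?P = "unif_prod {1..n}"
  let ?K = "\<lambda>W \<eta>. measure_pmf (conditional_tournament n W \<eta>)"
  have AE: "AE \<eta> in ?P. ?K V \<eta> = ?K W \<eta>"
    using AE_coordinate_pairs[OF eq, of "{1..n}", simplified]
    by (auto elim!: eventually_mono intro!: arg_cong[where f = measure_pmf] conditional_tournament_cong)
  have KW: "?K W \<in> completion ?P \<rightarrow>\<^sub>M subprob_algebra (count_space UNIV)"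
    by (rule measurable_completion_AE_eq[OF conditional_tournament_measurable AE])
       (auto intro: measure_pmf_in_subprob_algebra)
  show ?thesis
  proof (rule measure_eqI)
    show "sets (tournament_law n W) = sets (law n)"
      unfolding sets_law tournament_law_def latent_measure_def
      by (subst sets_bind[where N = "count_space UNIV"]) (auto simp: unif_prod.not_empty)
    fix A
    have "emeasure (tournament_law n W) A = (\<integral>\<^sup>+\<eta>. emeasure (?K W \<eta>) A \<partial>completion ?P)"
      unfolding tournament_law_def latent_measure_def
      by (rule emeasure_bind[OF _ KW]) (auto simp: unif_prod.not_empty)
    also have "\<dots> = (\<integral>\<^sup>+\<eta>. emeasure (?K V \<eta>) A \<partial>completion ?P)"
      by (rule nn_integral_cong_AE, rule AE_completion) (use AE in eventually_elim, simp)
    also have "\<dots> = (\<integral>\<^sup>+\<eta>. emeasure (?K V \<eta>) A \<partial>?P)"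
      by (rule nn_integral_completion)
    also have "\<dots> = emeasure (law n) A"
      unfolding law_def
      by (rule emeasure_bind[OF _ conditional_tournament_measurable, symmetric]) (auto simp: unif_prod.not_empty)
    finally show "emeasure (tournament_law n W) A = emeasure (law n) A" .
  qed
qed

lemma expectation_law_tr4:
  assumes "s \<in> quadruples n"
  shows "(\<integral>a. tr4_indicator a s \<partial>law n) = density_tr4"
proof -
  obtain a b c d where s: "s = (a, b, c, d)" by (cases s)
  have "(\<integral>a. tr4_indicator a s \<partial>law n) = (\<integral>\<eta>. tr4_at (\<lambda>u v. V (\<eta> u) (\<eta> v)) s \<partial>unif_prod {1..n})"
    using assms by (subst expectation_law) (auto simp: conditional_expectation_tr4 tr4_indicator_bounds)
  then show ?thesis
    using assms by (simp add: s tr4_at_def quadruples_def expectation_tr4)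
qed

lemma expectation_law_tr4_pair:
  assumes "s \<in> quadruples n" "s' \<in> quadruples n"
    and "\<not> (\<exists>u v. u \<noteq> v \<and> {u, v} \<subseteq> vertices s \<inter> vertices s')"
  shows "(\<integral>a. tr4_indicator a s * tr4_indicator a s' \<partial>law n)
    = (\<integral>\<eta>. tr4_at (\<lambda>u v. V (\<eta> u) (\<eta> v)) s * tr4_at (\<lambda>u v. V (\<eta> u) (\<eta> v)) s' \<partial>unif_prod {1..n})"
  using assms
  by (subst expectation_law)
     (auto simp: conditional_expectation_tr4_pair tr4_indicator_bounds abs_mult intro!: mult_le_one)

lemma expectation_law_tr4_disjoint:
  assumes s: "s \<in> quadruples n" "s' \<in> quadruples n" and disj: "vertices s \<inter> vertices s' = {}"
  shows "(\<integral>a. tr4_indicator a s * tr4_indicator a s' \<partial>law n) = density_tr4\<^sup>2"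
proof -
  obtain a b c d a' b' c' d' where abcd: "s = (a, b, c, d)" "s' = (a', b', c', d')"
    by (cases s, cases s')
  have "(\<integral>\<eta>. tr4 (\<lambda>u v. V (\<eta> u) (\<eta> v)) a b c d * tr4 (\<lambda>u v. V (\<eta> u) (\<eta> v)) a' b' c' d'
      \<partial>unif_prod {1..n}) = density_tr4\<^sup>2"
    using assms by (intro expectation_tr4_disjoint) (auto simp: abcd quadruples_def vertices_def)
  then show ?thesis
    using assms by (subst expectation_law_tr4_pair) (auto simp: abcd tr4_at_def)
qed

text \<open>For the constant kernel the conditional means are constant, so sharing a single vertex, and hence
  a latent variable, creates no correlation.\<close>

lemma expectation_law_tr4_half:
  assumes half: "AE p in unif \<Otimes>\<^sub>M unif. V (fst p) (snd p) = 1 / 2"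
    and s: "s \<in> quadruples n" "s' \<in> quadruples n"
    and no_edge: "\<not> (\<exists>u v. u \<noteq> v \<and> {u, v} \<subseteq> vertices s \<inter> vertices s')"
  shows "(\<integral>a. tr4_indicator a s * tr4_indicator a s' \<partial>law n) = density_tr4\<^sup>2"
proof -
  have const: "AE \<eta> in unif_prod {1..n}. tr4_at (\<lambda>u v. V (\<eta> u) (\<eta> v)) s = 1 / 64"
    and meas: "(\<lambda>\<eta>. tr4_at (\<lambda>u v. V (\<eta> u) (\<eta> v)) s) \<in> borel_measurable (unif_prod {1..n})"
    if "s \<in> quadruples n" for s
  proof -
    obtain a b c d where abcd: "s = (a, b, c, d)" by (cases s)
    show "AE \<eta> in unif_prod {1..n}. tr4_at (\<lambda>u v. V (\<eta> u) (\<eta> v)) s = 1 / 64"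
      using that unfolding abcd tr4_at_def prod.case
      by (intro AE_tr4_half[OF half]) (auto simp: quadruples_def)
    show "(\<lambda>\<eta>. tr4_at (\<lambda>u v. V (\<eta> u) (\<eta> v)) s) \<in> borel_measurable (unif_prod {1..n})"
      using that unfolding abcd tr4_at_def prod.case
      by (intro tr4_coordinates_measurable) (auto simp: quadruples_def)
  qed
  have "(\<integral>a. tr4_indicator a s * tr4_indicator a s' \<partial>law n)
    = (\<integral>\<eta>. tr4_at (\<lambda>u v. V (\<eta> u) (\<eta> v)) s * tr4_at (\<lambda>u v. V (\<eta> u) (\<eta> v)) s' \<partial>unif_prod {1..n})"
    by (rule expectation_law_tr4_pair[OF s no_edge])
  also have "\<dots> = (\<integral>\<eta>. (1 / 64)\<^sup>2 \<partial>unif_prod {1..n})"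
  proof (rule integral_cong_AE)
    show "AE \<eta> in unif_prod {1..n}. tr4_at (\<lambda>u v. V (\<eta> u) (\<eta> v)) s * tr4_at (\<lambda>u v. V (\<eta> u) (\<eta> v)) s' = (1 / 64)\<^sup>2"
      using const[OF s(1)] const[OF s(2)] by eventually_elim (simp only: power2_eq_square)
  qed (use meas[OF s(1)] meas[OF s(2)] in auto)
  also have "\<dots> = density_tr4\<^sup>2"
    using density_tr4_eq_iff half by (simp add: unif_prod.prob_space)
  finally show ?thesis .
qed

text \<open>The constant \<open>256 = 16\<^sup>2\<close> comes from \<open>card (quadruples n) \<ge> n\<^sup>4 / 16\<close>.\<close>

lemma t_hat_deviation:
  assumes n: "6 \<le> n" and r: "0 < r" and B: "B \<subseteq> quadruples n \<times> quadruples n"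
    and uncorrelated: "\<And>s s'. (s, s') \<in> quadruples n \<times> quadruples n - B \<Longrightarrow>
      (\<integral>a. tr4_indicator a s * tr4_indicator a s' \<partial>law n) = density_tr4\<^sup>2"
  shows "measure (law n) {a. \<bar>t_hat_Tr4 n a - density_tr4\<bar> \<ge> r} \<le> 256 * real (card B) / (real n ^ 8 * r\<^sup>2)"
proof -
  interpret law: prob_space "law n" by (rule prob_space_law)
  let ?N = "card (quadruples n)"
  have N: "real n ^ 4 / 16 \<le> ?N" by (rule card_quadruples_lower[OF n])
  have pos: "0 < real n ^ 4 / 16" using n by simp
  have Npos: "0 < real ?N" using N pos by linarith
  then have "quadruples n \<noteq> {}" by auto
  then have "law.prob {a \<in> space (law n). \<bar>(\<Sum>s\<in>quadruples n. tr4_indicator a s) / ?N - density_tr4\<bar> \<ge> r}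
      \<le> card B / (?N\<^sup>2 * r\<^sup>2)"
    by (intro law.mean_deviation_bound[OF finite_quadruples _ B _ _ _ _ _ r])
       (auto simp: measurable_law tr4_indicator_bounds expectation_law_tr4 uncorrelated)
  also have "\<dots> \<le> card B / ((real n ^ 4 / 16)\<^sup>2 * r\<^sup>2)"
    using N Npos pos r
    by (intro divide_left_mono mult_right_mono mult_pos_pos power_mono zero_less_power)
       (simp_all add: card_gt_0_iff finite_quadruples)
  finally show ?thesis
    using n by (simp add: space_law t_hat_Tr4_eq_mean power_divide mult_ac flip: power_mult)
qed

lemma t_hat_deviation_disjoint:
  assumes "6 \<le> n" "0 < r"
  shows "measure (law n) {a. \<bar>t_hat_Tr4 n a - density_tr4\<bar> \<ge> r} \<le> 4096 / (real n * r\<^sup>2)"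
proof -
  let ?B = "{(s, s') \<in> quadruples n \<times> quadruples n. vertices s \<inter> vertices s' \<noteq> {}}"
  have "measure (law n) {a. \<bar>t_hat_Tr4 n a - density_tr4\<bar> \<ge> r} \<le> 256 * real (card ?B) / (real n ^ 8 * r\<^sup>2)"
    by (rule t_hat_deviation[OF assms]) (auto intro!: expectation_law_tr4_disjoint)
  also have "\<dots> \<le> 256 * real (16 * n ^ 7) / (real n ^ 8 * r\<^sup>2)"
    by (intro divide_right_mono mult_left_mono of_nat_mono card_touching_pairs) auto
  also have "\<dots> = 4096 / (real n * r\<^sup>2)"
    using assms by (simp add: field_simps eval_nat_numeral)
  finally show ?thesis .
qed

lemma t_hat_deviation_half:
  assumes "6 \<le> n" "0 < r" and half: "AE p in unif \<Otimes>\<^sub>M unif. V (fst p) (snd p) = 1 / 2"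
  shows "measure (law n) {a. \<bar>t_hat_Tr4 n a - density_tr4\<bar> \<ge> r} \<le> 49152 / (real n ^ 2 * r\<^sup>2)"
proof -
  let ?B = "{(s, s') \<in> quadruples n \<times> quadruples n. \<exists>u v. u \<noteq> v \<and> {u, v} \<subseteq> vertices s \<inter> vertices s'}"
  have "measure (law n) {a. \<bar>t_hat_Tr4 n a - density_tr4\<bar> \<ge> r} \<le> 256 * real (card ?B) / (real n ^ 8 * r\<^sup>2)"
    by (rule t_hat_deviation[OF assms(1,2)]) (auto intro!: expectation_law_tr4_half[OF half])
  also have "\<dots> \<le> 256 * real (192 * n ^ 6) / (real n ^ 8 * r\<^sup>2)"
    by (intro divide_right_mono mult_left_mono of_nat_mono card_edge_sharing_pairs) auto
  also have "\<dots> = 49152 / (real n ^ 2 * r\<^sup>2)"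
    using assms by (simp add: field_simps eval_nat_numeral)
  finally show ?thesis .
qed

end

section \<open>The density as an integral over the completed cube\<close>

lemma unif_prod_eq_density:
  assumes K: "finite K"
  shows "unif_prod K = density (\<Pi>\<^sub>M i\<in>K. lborel) (indicator (\<Pi>\<^sub>E i\<in>K. {0..1}))"
proof -
  interpret product_sigma_finite "\<lambda>_ :: nat. unif"
    by (simp add: product_sigma_finite_def prob_space_imp_sigma_finite prob_space_unif)
  interpret L: product_sigma_finite "\<lambda>_ :: nat. lborel :: real measure"
    by (simp add: product_sigma_finite_def sigma_finite_lborel)
  let ?C = "\<Pi>\<^sub>E i\<in>K. {0..1 :: real}"
  show ?thesis
  proof (rule PiM_eqI[OF K, symmetric])
    show "sets (density (\<Pi>\<^sub>M i\<in>K. lborel) (indicator ?C)) = sets (unif_prod K)"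
      by (simp cong: sets_PiM_cong)
    fix A :: "nat \<Rightarrow> real set" assume "\<And>i. i \<in> K \<Longrightarrow> A i \<in> sets unif"
    then have A: "\<And>i. i \<in> K \<Longrightarrow> A i \<in> sets lborel" by simp
    have "emeasure (density (\<Pi>\<^sub>M i\<in>K. lborel) (indicator ?C)) (Pi\<^sub>E K A)
        = emeasure (\<Pi>\<^sub>M i\<in>K. lborel) (?C \<inter> Pi\<^sub>E K A)"
      using A K by (subst emeasure_density)
        (auto intro!: sets_PiM_I_finite simp: indicator_inter_arith[symmetric] simp flip: nn_integral_indicator)
    also have "?C \<inter> Pi\<^sub>E K A = (\<Pi>\<^sub>E i\<in>K. {0..1} \<inter> A i)" by auto
    also have "emeasure (\<Pi>\<^sub>M i\<in>K. lborel) \<dots> = (\<Prod>i\<in>K. emeasure lborel ({0..1} \<inter> A i))"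
      using A K by (intro L.emeasure_PiM) auto
    also have "\<dots> = (\<Prod>i\<in>K. emeasure unif (A i))"
      using A by (intro prod.cong) (auto simp: divide_ennreal_def)
    finally show "emeasure (density (\<Pi>\<^sub>M i\<in>K. lborel) (indicator ?C)) (Pi\<^sub>E K A) = \<dots>" .
  qed
qed

context tournament_kernel
begin

lemma t_Tr4_eq_density_tr4:
  assumes eq: "AE p in unif \<Otimes>\<^sub>M unif. W (fst p) (snd p) = V (fst p) (snd p)"
  shows "t_Tr4 W = density_tr4"
proof -
  let ?L = "\<Pi>\<^sub>M i\<in>{1..4::nat}. lborel :: real measure" and ?C = "\<Pi>\<^sub>E i\<in>{1..4::nat}. {0..1 :: real}"
  let ?E = "{(a, b). 1 \<le> a \<and> a < b \<and> b \<le> (4 :: nat)}"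
  let ?f = "\<lambda>W x. \<Prod>(a, b)\<in>?E. W (x a) (x b) :: real"
  have E: "?E = {(1, 2), (1, 3), (1, 4), (2, 3), (2, 4), (3, 4)}" by auto
  have C: "?C \<in> sets ?L" by (intro sets_PiM_I_finite) auto
  have fV: "?f V = (\<lambda>x. tr4 (\<lambda>u v. V (x u) (x v)) 1 2 3 4)"
    unfolding E by (simp add: tr4_def mult.assoc)
  have meas: "?f V \<in> borel_measurable ?L"
    using tr4_coordinates_measurable[of 1 2 3 4 "{1..4}"]
    unfolding fV by (simp cong: measurable_cong_sets sets_PiM_cong)
  have "AE x in unif_prod {1..4}. ?f V x = ?f W x"
    using AE_coordinate_pairs[OF eq, of "{1..4}", simplified]
    by eventually_elim (auto intro!: prod.cong)
  then have AE: "AE x in ?L. indicator ?C x *\<^sub>R ?f V x = indicator ?C x *\<^sub>R ?f W x"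
    using C by (subst (asm) unif_prod_eq_density) (auto simp: AE_density indicator_def elim!: eventually_mono)
  have "t_Tr4 W = (\<integral>x. indicator ?C x *\<^sub>R ?f W x \<partial>completion ?L)"
    unfolding t_Tr4_def set_lebesgue_integral_def ..
  also have "\<dots> = (\<integral>x. indicator ?C x *\<^sub>R ?f V x \<partial>completion ?L)"
  proof (rule integral_cong_AE)
    show m: "(\<lambda>x. indicator ?C x *\<^sub>R ?f V x) \<in> borel_measurable (completion ?L)"
      using C meas by (intro measurable_completion) auto
    show "(\<lambda>x. indicator ?C x *\<^sub>R ?f W x) \<in> borel_measurable (completion ?L)"
      using C meas by (intro measurable_completion_AE_eq[OF _ AE]) auto
    show "AE x in completion ?L. indicator ?C x *\<^sub>R ?f W x = indicator ?C x *\<^sub>R ?f V x"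
      by (rule AE_completion, rule eventually_mono[OF AE], rule sym)
  qed
  also have "\<dots> = (\<integral>x. indicator ?C x *\<^sub>R ?f V x \<partial>?L)"
    using C meas by (intro integral_completion) auto
  also have "\<dots> = (\<integral>x. ?f V x \<partial>unif_prod {1..4})"
    using C meas integral_density[of "?f V" ?L "indicator ?C"]
    by (simp add: unif_prod_eq_density ennreal_indicator)
  also have "\<dots> = density_tr4"
    unfolding fV by (rule expectation_tr4) auto
  finally show ?thesis .
qed

end

section \<open>Limit behaviour of the transitive count\<close>

theorem proposition4p3:
  fixes W :: "real \<Rightarrow> real \<Rightarrow> real"
    and M :: "nat \<Rightarrow> 'a measure"
    and T :: "nat \<Rightarrow> 'a \<Rightarrow> nat \<Rightarrow> nat \<Rightarrow> bool"
  assumes "tournamenton W"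
    and "\<And>n. W_random_tournament (M n) n W (T n)"
  shows "((AE (x, y) in lebesgue_on ({0..1} \<times> {0..1}). W x y = 1 / 2) \<longrightarrow>
           bounded_in_prob M (\<lambda>n \<omega>. real n * (t_hat_Tr4 n (T n \<omega>) - 1 / 64)))
       \<and> (emeasure lebesgue {(x, y). x \<in> {0..1} \<and> y \<in> {0..1} \<and> W x y \<noteq> 1 / 2} > 0 \<longrightarrow>
           tendsto_in_prob M (\<lambda>n \<omega>. t_hat_Tr4 n (T n \<omega>)) (t_Tr4 W) \<and> t_Tr4 W \<noteq> 1 / 64)"
proof -
  let ?S = "{0..1} \<times> {0..1} :: (real \<times> real) set"
  obtain V where "tournament_kernel V"
    and eq: "AE p in unif \<Otimes>\<^sub>M unif. W (fst p) (snd p) = V (fst p) (snd p)"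
    using tournamenton_AE_kernel[OF assms(1)] .
  interpret tournament_kernel V by fact
  let ?half = "AE p in unif \<Otimes>\<^sub>M unif. V (fst p) (snd p) = 1 / 2"
  have half_iff: "?half \<longleftrightarrow> (AE p in lebesgue. p \<in> ?S \<longrightarrow> W (fst p) (snd p) = 1 / 2)"
  proof -
    have "?half \<longleftrightarrow> (AE p in unif \<Otimes>\<^sub>M unif. W (fst p) (snd p) = 1 / 2)"
      using eq by (intro eventually_subst) (auto elim: eventually_mono)
    then show ?thesis by (simp add: AE_unif2_iff AE_completion_iff)
  qed
  have S: "?S \<in> sets lebesgue"
    by (intro sets_completionI_sets) (auto intro: borel_closed closed_Times)
  have transfer: "measure (M n) {\<omega> \<in> space (M n). P (T n \<omega>)} = measure (law n) {a. P a}" for n P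
  proof -
    have T: "T n \<in> M n \<rightarrow>\<^sub>M count_space UNIV" "distr (M n) (count_space UNIV) (T n) = law n"
      using assms(2)[of n] tournament_law_eq_law[OF eq] by (auto simp: W_random_tournament_def)
    show ?thesis
      unfolding T(2)[symmetric] by (subst measure_distr[OF T(1)]) (auto simp: vimage_def Int_def conj_commute)
  qed
  have "bounded_in_prob M (\<lambda>n \<omega>. real n * (t_hat_Tr4 n (T n \<omega>) - 1 / 64))"
    if "AE (x, y) in lebesgue_on ?S. W x y = 1 / 2"
    unfolding bounded_in_prob_def
  proof (intro allI impI)
    fix \<epsilon> :: real assume \<epsilon>: "0 < \<epsilon>"
    have half: ?half
      unfolding half_iff using that S by (subst (asm) AE_restrict_space_iff) (auto simp: case_prod_beta)
    then have t: "density_tr4 = 1 / 64" by (simp only: density_tr4_eq_iff)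
    \<comment> \<open>Chebyshev at distance \<open>K / n\<close> bounds the probability by \<open>49152 / K\<^sup>2\<close>.\<close>
    define K where "K = sqrt (49152 / \<epsilon>)"
    have K: "0 < K" "K\<^sup>2 = 49152 / \<epsilon>" using \<epsilon> by (auto simp: K_def)
    have "measure (M n) {\<omega> \<in> space (M n). K < \<bar>real n * (t_hat_Tr4 n (T n \<omega>) - 1 / 64)\<bar>} \<le> \<epsilon>"
      if n: "6 \<le> n" for n
    proof -
      interpret law: prob_space "law n" by (rule prob_space_law)
      have "measure (law n) {a. K < \<bar>real n * (t_hat_Tr4 n a - 1 / 64)\<bar>}
          \<le> measure (law n) {a. \<bar>t_hat_Tr4 n a - density_tr4\<bar> \<ge> K / n}"
        using n by (intro law.finite_measure_mono) (auto simp: sets_law t abs_mult pos_divide_le_eq mult.commute)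
      also have "\<dots> \<le> 49152 / (real n ^ 2 * (K / n)\<^sup>2)"
        using n K by (intro t_hat_deviation_half half) auto
      also have "\<dots> = \<epsilon>"
        using n \<epsilon> by (simp add: power_divide K(2))
      finally show ?thesis by (subst transfer)
    qed
    then show "\<exists>K>0. \<forall>\<^sub>F n in sequentially.
        measure (M n) {\<omega> \<in> space (M n). K < \<bar>real n * (t_hat_Tr4 n (T n \<omega>) - 1 / 64)\<bar>} \<le> \<epsilon>"
      using K(1) by (auto simp: eventually_sequentially)
  qed
  moreover have "tendsto_in_prob M (\<lambda>n \<omega>. t_hat_Tr4 n (T n \<omega>)) (t_Tr4 W)"
    unfolding tendsto_in_prob_def t_Tr4_eq_density_tr4[OF eq]
  proof (intro allI impI)
    fix \<epsilon> :: real assume \<epsilon>: "0 < \<epsilon>"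
    show "(\<lambda>n. measure (M n) {\<omega> \<in> space (M n). \<epsilon> < \<bar>t_hat_Tr4 n (T n \<omega>) - density_tr4\<bar>}) \<longlonglongrightarrow> 0"
    proof (rule tendsto_sandwich[OF _ _ tendsto_const])
      show "\<forall>\<^sub>F n in sequentially. measure (M n) {\<omega> \<in> space (M n). \<epsilon> < \<bar>t_hat_Tr4 n (T n \<omega>) - density_tr4\<bar>}
          \<le> 4096 / \<epsilon>\<^sup>2 * (1 / real n)"
      proof (rule eventually_sequentiallyI[of 6])
        fix n :: nat assume n: "6 \<le> n"
        interpret law: prob_space "law n" by (rule prob_space_law)
        have "measure (law n) {a. \<epsilon> < \<bar>t_hat_Tr4 n a - density_tr4\<bar>}
            \<le> measure (law n) {a. \<bar>t_hat_Tr4 n a - density_tr4\<bar> \<ge> \<epsilon>}"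
          by (intro law.finite_measure_mono) (auto simp: sets_law)
        also have "\<dots> \<le> 4096 / (real n * \<epsilon>\<^sup>2)"
          by (rule t_hat_deviation_disjoint[OF n \<epsilon>])
        finally show "measure (M n) {\<omega> \<in> space (M n). \<epsilon> < \<bar>t_hat_Tr4 n (T n \<omega>) - density_tr4\<bar>}
            \<le> 4096 / \<epsilon>\<^sup>2 * (1 / real n)"
          by (subst transfer) (simp add: mult.commute)
      qed
      show "(\<lambda>n. 4096 / \<epsilon>\<^sup>2 * (1 / real n)) \<longlonglongrightarrow> 0"
        by (rule tendsto_mult_right_zero[OF lim_1_over_n])
    qed (auto intro: always_eventually)
  qed
  moreover have "t_Tr4 W \<noteq> 1 / 64"
    if pos: "0 < emeasure lebesgue {(x, y). x \<in> {0..1} \<and> y \<in> {0..1} \<and> W x y \<noteq> 1 / 2}"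
  proof
    assume "t_Tr4 W = 1 / 64"
    then have "AE p in lebesgue. p \<in> ?S \<longrightarrow> W (fst p) (snd p) = 1 / 2"
      by (simp only: t_Tr4_eq_density_tr4[OF eq] density_tr4_eq_iff half_iff)
    then have "emeasure lebesgue {p \<in> space lebesgue. \<not> (p \<in> ?S \<longrightarrow> W (fst p) (snd p) = 1 / 2)} = 0"
      by (intro emeasure_eq_0_AE) simp
    also have "{p \<in> space lebesgue. \<not> (p \<in> ?S \<longrightarrow> W (fst p) (snd p) = 1 / 2)}
        = {(x, y). x \<in> {0..1} \<and> y \<in> {0..1} \<and> W x y \<noteq> 1 / 2}" by auto
    finally show False using pos by simp
  qed
  ultimately show ?thesis by blast
qed

end
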